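(* Let $\alpha,\beta\in\mathbb{R}$ with $1<\alpha<\beta$, let $\mathbf{R}$ and $\mathbf{S}$ be the self-similar generalized $4$-systems attached to $\alpha$ and $\beta$ as described in the context, and let $T=(T_1,\dots,T_5)\colon\mathbb{R}^4\to\mathbb{R}^5$ be the linear map with components \begin{align*} T_1(\mathbf{x}) &= -(\alpha-1)\beta x_1 - (\beta-\alpha) x_2 + (\beta-1)x_4,\\ T_2(\mathbf{x}) &= (\alpha-1) \beta x_1 - (\alpha-1)\beta x_2 + \alpha(\beta-1)x_3 - (\beta-1)x_4,\\ T_3(\mathbf{x}) &= \alpha\beta(\alpha-1)x_1 - \alpha(\alpha-1)x_2 + (\beta-1)x_3 - (\beta-1)x_4,\\ T_4(\mathbf{x}) &= x_3-x_4,\\ T_5(\mathbf{x}) &= -x_2 + x_4, \end{align*} where $\mathbf{x}=(x_1,\dots,x_4)$. Then there exists no proper $4$-system $\mathbf{P}$ such that $\mu_T(\mathbf{P})=\min\{\mu_T(\mathbf{R}),\mu_T(\mathbf{S})\}$.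
   Context: **$n$-systems.** Let $n\ge 2$, let $\mathbf{e}_1,\dots,\mathbf{e}_n$ be the canonical basis of $\mathbb{R}^n$, and let $I$ be a closed subinterval of $[0,\infty)$ with non-empty interior. An $n$-system on $I$ is a map $\mathbf{P}=(P_1,\dots,P_n)\colon I\to\mathbb{R}^n$ such that, for any $q\in I$: (S1) $0\le P_1(q)\le\cdots\le P_n(q)$ and $P_1(q)+\cdots+P_n(q)=q$; (S2) there exist $\epsilon>0$ and integers $k,\ell\in\{1,\dots,n\}$ such that $\mathbf{P}(t)=\mathbf{P}(q)+(t-q)\mathbf{e}_\ell$ for any $t\in I\cap[q-\epsilon,q]$ and $\mathbf{P}(t)=\mathbf{P}(q)+(t-q)\mathbf{e}_k$ for any $t\in I\cap[q,q+\epsilon]$; (S3) if $q$ is in the interior of $I$ and if the integers $k,\ell$ from (S2) satisfy $k>\ell$, then $P_\ell(q)=\cdots=P_k(q)$. It is called proper if $I=[q_0,\infty)$ for some $q_0\ge 0$ and $\lim_{q\to\infty}P_1(q)=\infty$. **Generalized $n$-systems.** A generalized $n$-system on $I$ is a continuous piecewise linear map $\mathbf{P}=(P_1,\dots,P_n)\colon I\to\mathbb{R}^n$ such that: (G1) condition (S1) holds for each $q\in I$; (G2) each $P_j$ is monotone increasing and $1$-Lipschitz; (G3) for each $j=1,\dots,n-1$ and each subinterval $H$ of $I$ on which $P_j<P_{j+1}$, the sum $P_1+\cdots+P_j$ is convex on $H$ with slopes in $\{0,1\}$. Its division points are its values at the boundary points of $I$ and at the interior points of $I$ where it is not differentiable.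 **The maps $\mathbf{R}$ and $\mathbf{S}$.** $\mathbf{R}=(R_1,\dots,R_4)$ is the unique generalized $4$-system on $[3+\alpha,\alpha(3+\alpha)]$ with $R_1=R_2$ whose division points are $$A_1=(1,1,1,\alpha),\ A_2=(1,1,\alpha,\alpha),\ A_3=(1,1,\alpha,\alpha^2),\ \alpha A_1=(\alpha,\alpha,\alpha,\alpha^2),$$ extended to $[3+\alpha,\infty)$ by $\mathbf{R}(\alpha q)=\alpha\mathbf{R}(q)$ for each $q\ge 3+\alpha$. $\mathbf{S}=(S_1,\dots,S_4)$ is the unique generalized $4$-system on $[1+3\beta,\beta(1+3\beta)]$ with $S_3=S_4$ whose division points are $$B_1=(1,\beta,\beta,\beta),\ B_2=(1,\beta,\beta^2,\beta^2),\ B_3=(\beta,\beta,\beta^2,\beta^2),\ \beta B_1=(\beta,\beta^2,\beta^2,\beta^2),$$ extended to $[1+3\beta,\infty)$ by $\mathbf{S}(\beta q)=\beta\mathbf{S}(q)$ for each $q\ge 1+3\beta$. (Concretely, on the initial interval each map takes each listed division point as its value at the sum of that point's coordinates, and is affine between consecutive such parameters.) **The quantity $\mu_T$.** For a linear map $T=(T_1,\dots,T_m)\colon\mathbb{R}^n\to\mathbb{R}^m$ and a Lipschitz map $\mathbf{P}\colon[q_0,\infty)\to\mathbb{R}^n$, $$\mu_T(\mathbf{P})=\Big(\liminf_{q\to\infty}q^{-1}T_1(\mathbf{P}(q)),\dots,\liminf_{q\to\infty}q^{-1}T_m(\mathbf{P}(q))\Big).$$ The minimum of two points of $\mathbb{R}^m$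 is their coordinate-wise minimum. *)

theory Defs
  imports "HOL-Analysis.Analysis"
begin

text \<open>
  A point of \<open>n\<close>-space is a function \<open>x :: nat \<Rightarrow> real\<close> of which only the coordinates
  \<open>x 1, \<dots>, x n\<close> are relevant, so that the dimension is an ordinary number and the
  coordinates are linearly ordered by their index. A map \<open>P\<close> into \<open>n\<close>-space has type
  \<open>real \<Rightarrow> nat \<Rightarrow> real\<close>; \<open>P q j\<close> is the \<open>j\<close>-th coordinate at \<open>q\<close>. Everything below
  depends only on the values of \<open>P\<close> on the interval \<open>I\<close> and on the coordinates in \<open>{1..n}\<close>.
\<close>

definition system_domain :: "real set \<Rightarrow> bool" where
  "system_domain I \<longleftrightarrow> is_interval I \<and> closed I \<and> interior I \<noteq> {} \<and> I \<subseteq> {0..}"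

definition S1_at :: "nat \<Rightarrow> (real \<Rightarrow> nat \<Rightarrow> real) \<Rightarrow> real \<Rightarrow> bool" where
  "S1_at n P q \<longleftrightarrow>
     0 \<le> P q 1 \<and> (\<forall>j\<in>{1..<n}. P q j \<le> P q (j + 1)) \<and> (\<Sum>j = 1..n. P q j) = q"

definition S2_at :: "nat \<Rightarrow> real set \<Rightarrow> (real \<Rightarrow> nat \<Rightarrow> real) \<Rightarrow> real \<Rightarrow> nat \<Rightarrow> nat \<Rightarrow> bool" where
  "S2_at n I P q k l \<longleftrightarrow> k \<in> {1..n} \<and> l \<in> {1..n} \<and>
     (\<exists>\<epsilon>>0.
        (\<forall>t \<in> I \<inter> {q - \<epsilon>..q}. \<forall>j\<in>{1..n}. P t j = P q j + (t - q) * (if j = l then 1 else 0)) \<and>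
        (\<forall>t \<in> I \<inter> {q..q + \<epsilon>}. \<forall>j\<in>{1..n}. P t j = P q j + (t - q) * (if j = k then 1 else 0)))"

definition n_system :: "nat \<Rightarrow> real set \<Rightarrow> (real \<Rightarrow> nat \<Rightarrow> real) \<Rightarrow> bool" where
  "n_system n I P \<longleftrightarrow> 2 \<le> n \<and> system_domain I \<and>
     (\<forall>q\<in>I. S1_at n P q \<and>
            (\<exists>k l. S2_at n I P q k l) \<and>
            (\<forall>k l. q \<in> interior I \<and> S2_at n I P q k l \<and> l < k \<longrightarrow> (\<forall>j\<in>{l..k}. P q j = P q l)))"

definition proper_n_system :: "nat \<Rightarrow> real \<Rightarrow> (real \<Rightarrow> nat \<Rightarrow> real) \<Rightarrow> bool" where
  "proper_n_system n q0 P \<longleftrightarrow>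
     0 \<le> q0 \<and> n_system n {q0..} P \<and> filterlim (\<lambda>q. P q 1) at_top at_top"

text \<open>
  Being affine on a one-sided neighbourhood on either side of each point of a closed interval
  amounts to being continuous and affine between consecutive terms of a locally finite set of
  break points.
\<close>

definition piecewise_linear_on :: "real set \<Rightarrow> (real \<Rightarrow> real) \<Rightarrow> bool" where
  "piecewise_linear_on I f \<longleftrightarrow>
     (\<forall>q\<in>I. \<exists>\<epsilon>>0. \<exists>a b.
        (\<forall>t \<in> I \<inter> {q - \<epsilon>..q}. f t = f q + (t - q) * a) \<and>
        (\<forall>t \<in> I \<inter> {q..q + \<epsilon>}. f t = f q + (t - q) * b))"

definition generalized_n_system :: "nat \<Rightarrow> real set \<Rightarrow> (real \<Rightarrow> nat \<Rightarrow> real) \<Rightarrow> bool" where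
  "generalized_n_system n I P \<longleftrightarrow> 2 \<le> n \<and> system_domain I \<and>
     (\<forall>j\<in>{1..n}. continuous_on I (\<lambda>q. P q j) \<and> piecewise_linear_on I (\<lambda>q. P q j)) \<and>
     (\<forall>q\<in>I. S1_at n P q) \<and>
     (\<forall>j\<in>{1..n}. mono_on I (\<lambda>q. P q j) \<and> 1-lipschitz_on I (\<lambda>q. P q j)) \<and>
     (\<forall>j\<in>{1..<n}. \<forall>H. is_interval H \<and> H \<subseteq> I \<and> (\<forall>q\<in>H. P q j < P q (j + 1)) \<longrightarrow>
        convex_on H (\<lambda>q. \<Sum>i = 1..j. P q i) \<and>
        (\<forall>q\<in>interior H. \<forall>s. ((\<lambda>q. \<Sum>i = 1..j. P q i) has_real_derivative s) (at q) \<longrightarrow> s \<in> {0, 1}))"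

text \<open>Points are restricted to their relevant coordinates so that they can be compared by equality.\<close>

definition division_points :: "nat \<Rightarrow> real set \<Rightarrow> (real \<Rightarrow> nat \<Rightarrow> real) \<Rightarrow> (nat \<Rightarrow> real) set" where
  "division_points n I P =
     (\<lambda>q. restrict (P q) {1..n}) `
       (frontier I \<union> {q \<in> interior I. \<not> (\<forall>j\<in>{1..n}. (\<lambda>t. P t j) differentiable (at q))})"

definition point :: "real list \<Rightarrow> nat \<Rightarrow> real" where
  "point xs = (\<lambda>j\<in>{1..length xs}. xs ! (j - 1))"

definition is_R :: "real \<Rightarrow> (real \<Rightarrow> nat \<Rightarrow> real) \<Rightarrow> bool" where
  "is_R \<alpha> R \<longleftrightarrow>
     generalized_n_system 4 {3 + \<alpha>..\<alpha> * (3 + \<alpha>)} R \<and>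
     (\<forall>q\<in>{3 + \<alpha>..\<alpha> * (3 + \<alpha>)}. R q 1 = R q 2) \<and>
     division_points 4 {3 + \<alpha>..\<alpha> * (3 + \<alpha>)} R =
       {point [1, 1, 1, \<alpha>], point [1, 1, \<alpha>, \<alpha>], point [1, 1, \<alpha>, \<alpha>\<^sup>2], point [\<alpha>, \<alpha>, \<alpha>, \<alpha>\<^sup>2]} \<and>
     (\<forall>q\<ge>3 + \<alpha>. \<forall>j\<in>{1..4}. R (\<alpha> * q) j = \<alpha> * R q j)"

definition is_S :: "real \<Rightarrow> (real \<Rightarrow> nat \<Rightarrow> real) \<Rightarrow> bool" where
  "is_S \<beta> S \<longleftrightarrow>
     generalized_n_system 4 {1 + 3 * \<beta>..\<beta> * (1 + 3 * \<beta>)} S \<and>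
     (\<forall>q\<in>{1 + 3 * \<beta>..\<beta> * (1 + 3 * \<beta>)}. S q 3 = S q 4) \<and>
     division_points 4 {1 + 3 * \<beta>..\<beta> * (1 + 3 * \<beta>)} S =
       {point [1, \<beta>, \<beta>, \<beta>], point [1, \<beta>, \<beta>\<^sup>2, \<beta>\<^sup>2], point [\<beta>, \<beta>, \<beta>\<^sup>2, \<beta>\<^sup>2], point [\<beta>, \<beta>\<^sup>2, \<beta>\<^sup>2, \<beta>\<^sup>2]} \<and>
     (\<forall>q\<ge>1 + 3 * \<beta>. \<forall>j\<in>{1..4}. S (\<beta> * q) j = \<beta> * S q j)"

text \<open>
  The lower limits are taken in the extended reals, where they always exist; they are finite for a
  Lipschitz map \<open>P\<close> and a linear map \<open>T\<close>.
\<close>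

definition mu :: "((nat \<Rightarrow> real) \<Rightarrow> nat \<Rightarrow> real) \<Rightarrow> (real \<Rightarrow> nat \<Rightarrow> real) \<Rightarrow> nat \<Rightarrow> ereal" where
  "mu T P i = Liminf at_top (\<lambda>q. ereal (inverse q * T (P q) i))"

definition T_map :: "real \<Rightarrow> real \<Rightarrow> (nat \<Rightarrow> real) \<Rightarrow> nat \<Rightarrow> real" where
  "T_map \<alpha> \<beta> x = point
     [- (\<alpha> - 1) * \<beta> * x 1 - (\<beta> - \<alpha>) * x 2 + (\<beta> - 1) * x 4,
      (\<alpha> - 1) * \<beta> * x 1 - (\<alpha> - 1) * \<beta> * x 2 + \<alpha> * (\<beta> - 1) * x 3 - (\<beta> - 1) * x 4,
      \<alpha> * \<beta> * (\<alpha> - 1) * x 1 - \<alpha> * (\<alpha> - 1) * x 2 + (\<beta> - 1) * x 3 - (\<beta> - 1) * x 4,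
      x 3 - x 4,
      - x 2 + x 4]"

end

theory Submission
  imports Defs
begin

text \<open>
  Put \<open>u = \<beta> x\<^sub>1 - x\<^sub>2\<close> and \<open>d = x\<^sub>2 - x\<^sub>1\<close>. As \<open>T\<^sub>1 + T\<^sub>2\<close> is a multiple of \<open>x\<^sub>3 - x\<^sub>2\<close>, a system \<open>P\<close> whose
  first three lower limits are nonnegative has \<open>T\<^sub>1\<close> and \<open>T\<^sub>2\<close> negligible whenever \<open>P\<^sub>2 = P\<^sub>3\<close>, so that up to
  scaling and small errors its position at such a time is given by the ratio \<open>u / d\<close>, which is infinite on \<open>R\<close>
  and zero on \<open>S\<close>. If \<open>P\<^sub>1\<close> does not grow before the next such time, the ratio does not increase. If it
  does, \<open>P\<^sub>1\<close> must reach the old value of \<open>P\<^sub>2\<close>, while \<open>T\<^sub>3 \<ge> 0\<close> lets \<open>u\<close> grow at most by the factor \<open>\<alpha>\<close>;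
  since \<open>\<alpha> < \<beta>\<close>, a small ratio then stays small. The value \<open>0\<close> of the fifth lower limit brings \<open>P\<close> close
  to \<open>S\<close>, hence the ratio stays small from then on, whereas the value of the fourth one requires \<open>P\<close> to come
  back close to \<open>R\<close>.
\<close>

section \<open>Induction along an interval\<close>

text \<open>Real induction: \<open>left\<close> carries \<open>Q\<close> to the supremum of the
  initial segments on which it holds, and \<open>right\<close> pushes beyond this supremum unless it
  is \<open>b\<close>. It turns the local condition (S2) into statements on whole intervals.\<close>

lemma interval_induct:
  fixes a b :: real
  assumes "a \<le> b" and base: "Q a"
    and right: "\<And>q. \<lbrakk>a \<le> q; q < b; \<And>r. a \<le> r \<Longrightarrow> r \<le> q \<Longrightarrow> Q r\<rbrakk>
                  \<Longrightarrow> \<exists>e>0. \<forall>r. q < r \<and> r \<le> q + e \<and> r \<le> b \<longrightarrow> Q r"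
    and left: "\<And>q. \<lbrakk>a < q; q \<le> b; \<And>r. a \<le> r \<Longrightarrow> r < q \<Longrightarrow> Q r\<rbrakk> \<Longrightarrow> Q q"
    and "a \<le> q" "q \<le> b"
  shows "Q q"
proof -
  define X where "X = {m. a \<le> m \<and> m \<le> b \<and> (\<forall>r. a \<le> r \<and> r \<le> m \<longrightarrow> Q r)}"
  define m where "m = Sup X"
  have aX: "a \<in> X" using assms(1) base by (auto simp: X_def)
  have bdd: "bdd_above X" by (auto simp: X_def)
  have am: "a \<le> m" using aX bdd by (simp add: m_def cSup_upper)
  have mb: "m \<le> b" unfolding m_def using aX by (intro cSup_least) (auto simp: X_def)
  have below: "Q r" if r: "a \<le> r" "r < m" for r
  proof -
    obtain x where "x \<in> X" "r < x"
      using less_cSupD[of X r] r aX unfolding m_def by blast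
    then show ?thesis using r by (auto simp: X_def)
  qed
  have "Q m" using left[of m] below am mb base by (cases "m = a") auto
  then have upto: "Q r" if "a \<le> r" "r \<le> m" for r
    using below[of r] that by (cases "r = m") auto
  have "m = b"
  proof (rule ccontr)
    assume "m \<noteq> b"
    then have "m < b" using mb by simp
    then obtain e where e: "e > 0" "\<forall>r. m < r \<and> r \<le> m + e \<and> r \<le> b \<longrightarrow> Q r"
      using right[of m] upto am by blast
    define m' where "m' = min (m + e) b"
    have "Q r" if "a \<le> r" "r \<le> m'" for r
      using upto[of r] e that unfolding m'_def by (cases "r \<le> m") auto
    then have "m' \<in> X" using am \<open>m < b\<close> e(1) unfolding m'_def X_def by auto
    then have "m' \<le> m" unfolding m_def using bdd by (simp add: cSup_upper)
    then show False using e(1) \<open>m < b\<close> unfolding m'_def by simp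
  qed
  then show ?thesis using upto assms by blast
qed

section \<open>Systems\<close>

lemma n_system_S1:
  assumes "n_system n I P" "q \<in> I"
  shows "0 \<le> P q 1" "j \<in> {1..<n} \<Longrightarrow> P q j \<le> P q (j + 1)" "(\<Sum>j = 1..n. P q j) = q"
  using assms unfolding n_system_def S1_at_def by auto

lemma n_system_subset:
  assumes "n_system n I P" "a \<in> I" "b \<in> I"
  shows "{a..b} \<subseteq> I"
  using assms unfolding n_system_def system_domain_def is_interval_1 by (meson atLeastAtMost_iff subsetI)

lemma n_system_S2:
  assumes "n_system n I P" "q \<in> I"
  obtains k l where "S2_at n I P q k l"
  using assms unfolding n_system_def by metis

lemma n_system_S3:
  assumes "n_system n I P" "q \<in> interior I" "S2_at n I P q k l" "l < k" "j \<in> {l..k}"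
  shows "P q j = P q l"
proof -
  have "q \<in> I" using assms(2) interior_subset by blast
  then show ?thesis using assms unfolding n_system_def by metis
qed

lemma S2_at_right:
  assumes "S2_at n I P q k l"
  obtains e where "e > 0"
    "\<forall>t j. t \<in> I \<longrightarrow> q \<le> t \<longrightarrow> t \<le> q + e \<longrightarrow> j \<in> {1..n} \<longrightarrow> P t j = P q j + (if j = k then t - q else 0)"
proof -
  from assms obtain e where "e > 0" and
    "\<forall>t \<in> I \<inter> {q..q + e}. \<forall>j\<in>{1..n}. P t j = P q j + (t - q) * (if j = k then 1 else 0)"
    unfolding S2_at_def by blast
  then show thesis by (intro that[of e]) simp_all
qed

lemma S2_at_left:
  assumes "S2_at n I P q k l"
  obtains e where "e > 0"
    "\<forall>t j. t \<in> I \<longrightarrow> q - e \<le> t \<longrightarrow> t \<le> q \<longrightarrow> j \<in> {1..n} \<longrightarrow> P t j = P q j + (if j = l then t - q else 0)"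
proof -
  from assms obtain e where "e > 0" and
    "\<forall>t \<in> I \<inter> {q - e..q}. \<forall>j\<in>{1..n}. P t j = P q j + (t - q) * (if j = l then 1 else 0)"
    unfolding S2_at_def by blast
  then show thesis by (intro that[of e]) simp_all
qed

lemma n_system_continuous:
  assumes sys: "n_system n I P" and j: "j \<in> {1..n}"
  shows "continuous_on I (\<lambda>q. P q j)"
  unfolding continuous_on_iff
proof (intro ballI allI impI)
  fix q e :: real assume q: "q \<in> I" and e: "0 < e"
  obtain k l where kl: "S2_at n I P q k l" using n_system_S2[OF sys q] .
  obtain e1 where e1: "e1 > 0"
    "\<forall>t j. t \<in> I \<longrightarrow> q \<le> t \<longrightarrow> t \<le> q + e1 \<longrightarrow> j \<in> {1..n} \<longrightarrow> P t j = P q j + (if j = k then t - q else 0)"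
    using S2_at_right[OF kl] .
  obtain e2 where e2: "e2 > 0"
    "\<forall>t j. t \<in> I \<longrightarrow> q - e2 \<le> t \<longrightarrow> t \<le> q \<longrightarrow> j \<in> {1..n} \<longrightarrow> P t j = P q j + (if j = l then t - q else 0)"
    using S2_at_left[OF kl] .
  define \<delta> where "\<delta> = min e (min e1 e2)"
  have "dist (P t j) (P q j) < e" if "t \<in> I" "dist t q < \<delta>" for t
    using e1(2)[rule_format, of t j] e2(2)[rule_format, of t j] that j e
    unfolding \<delta>_def dist_real_def by (cases "q \<le> t") (auto split: if_splits)
  moreover have "\<delta> > 0" using e e1 e2 by (auto simp: \<delta>_def)
  ultimately show "\<exists>d>0. \<forall>x'\<in>I. dist x' q < d \<longrightarrow> dist (P x' j) (P q j) < e" by blast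
qed

lemma n_system_mono:
  assumes sys: "n_system n I P" and j: "j \<in> {1..n}" and "a \<in> I" "b \<in> I" "a \<le> b"
  shows "P a j \<le> P b j"
proof (rule interval_induct[where Q = "\<lambda>q. P a j \<le> P q j" and a = a and b = b and q = b])
  fix q assume q: "a \<le> q" "q < b" and IH: "\<And>r. a \<le> r \<Longrightarrow> r \<le> q \<Longrightarrow> P a j \<le> P r j"
  have sub: "{a..b} \<subseteq> I" using n_system_subset[OF sys] assms by blast
  have qI: "q \<in> I" using sub q by auto
  obtain k l where kl: "S2_at n I P q k l" using n_system_S2[OF sys qI] .
  obtain e where e: "e > 0"
    "\<forall>t j. t \<in> I \<longrightarrow> q \<le> t \<longrightarrow> t \<le> q + e \<longrightarrow> j \<in> {1..n} \<longrightarrow> P t j = P q j + (if j = k then t - q else 0)"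
    using S2_at_right[OF kl] .
  show "\<exists>e>0. \<forall>r. q < r \<and> r \<le> q + e \<and> r \<le> b \<longrightarrow> P a j \<le> P r j"
  proof (intro exI[of _ e] conjI allI impI e(1))
    fix r assume r: "q < r \<and> r \<le> q + e \<and> r \<le> b"
    have "r \<in> I" using sub r q by auto
    then have "P r j = P q j + (if j = k then r - q else 0)" using e(2)[rule_format, of r j] r j by auto
    then show "P a j \<le> P r j" using IH[of q] q r by (auto split: if_splits)
  qed
next
  fix q assume q: "a < q" "q \<le> b" and IH: "\<And>r. a \<le> r \<Longrightarrow> r < q \<Longrightarrow> P a j \<le> P r j"
  have sub: "{a..b} \<subseteq> I" using n_system_subset[OF sys] assms by blast
  have qI: "q \<in> I" using sub q by auto
  obtain k l where kl: "S2_at n I P q k l" using n_system_S2[OF sys qI] .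
  obtain e where e: "e > 0"
    "\<forall>t j. t \<in> I \<longrightarrow> q - e \<le> t \<longrightarrow> t \<le> q \<longrightarrow> j \<in> {1..n} \<longrightarrow> P t j = P q j + (if j = l then t - q else 0)"
    using S2_at_left[OF kl] .
  define r where "r = max a (q - e)"
  have r: "a \<le> r" "r < q" "q - e \<le> r" using q e by (auto simp: r_def)
  have "r \<in> I" using sub r q by auto
  then have "P r j = P q j + (if j = l then r - q else 0)" using e(2)[rule_format, of r j] r j by auto
  then show "P a j \<le> P q j" using IH[of r] r by (auto split: if_splits)
qed (use assms in auto)

text \<open>
  By (S3) the index of the growing coordinate cannot pass from \<open>{1..j}\<close> to \<open>{j+1..n}\<close> as long as
  \<open>P\<^sub>j < P\<^sub>j\<^sub>+\<^sub>1\<close>.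
\<close>

lemma n_system_upper_const:
  assumes sys: "n_system n I P" and a: "a \<in> I" and t: "t \<in> I" and j: "j \<in> {1..<n}"
    and k: "S2_at n I P a k l" "k \<le> j"
    and gap: "\<And>q. a \<le> q \<Longrightarrow> q < t \<Longrightarrow> P q j < P q (j + 1)"
    and q: "a \<le> q" "q \<le> t" and i: "i \<in> {j + 1..n}"
  shows "P q i = P a i"
proof -
  have sub: "{a..t} \<subseteq> I" using n_system_subset[OF sys a t] .
  have "\<forall>i\<in>{j + 1..n}. P q i = P a i"
  proof (rule interval_induct[where Q = "\<lambda>q. \<forall>i\<in>{j + 1..n}. P q i = P a i" and a = a and b = t])
    fix q assume q: "a \<le> q" "q < t"
      and IH: "\<And>r. a \<le> r \<Longrightarrow> r \<le> q \<Longrightarrow> \<forall>i\<in>{j + 1..n}. P r i = P a i"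
    have qI: "q \<in> I" using sub q by auto
    \<comment> \<open>The growing index at \<open>q\<close> is still at most \<open>j\<close>: an
      index above \<open>j\<close> just before \<open>q\<close> would contradict the constancy known
      so far, and a change from \<open>l' \<le> j\<close> to \<open>k' > j\<close> would by (S3)
      give \<open>P q j = P q (j + 1)\<close>, against \<open>gap\<close>.\<close>
    have "\<exists>k' l'. S2_at n I P q k' l' \<and> k' \<le> j"
    proof (cases "q = a")
      case True
      show ?thesis unfolding True using k by (intro exI conjI)
    next
      case False
      then have aq: "a < q" using q by simp
      obtain k' l' where kl: "S2_at n I P q k' l'" using n_system_S2[OF sys qI] .
      have rng: "k' \<in> {1..n}" "l' \<in> {1..n}" using kl by (auto simp: S2_at_def)
      obtain e where e: "e > 0"
        "\<forall>t j. t \<in> I \<longrightarrow> q - e \<le> t \<longrightarrow> t \<le> q \<longrightarrow> j \<in> {1..n} \<longrightarrow> P t j = P q j + (if j = l' then t - q else 0)"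
        using S2_at_left[OF kl] .
      define r where "r = max a (q - e)"
      have r: "a \<le> r" "r < q" "q - e \<le> r" using aq e by (auto simp: r_def)
      have "r \<in> I" using sub r q by auto
      then have rl: "P r l' = P q l' + (r - q)" using e(2)[rule_format, of r l'] r rng by auto
      have l': "l' \<le> j"
      proof (rule ccontr)
        assume "\<not> l' \<le> j"
        then have "P r l' = P a l'" "P q l' = P a l'" using IH[of r] IH[of q] r q rng by auto
        then show False using rl r by simp
      qed
      have int: "q \<in> interior I"
        using aq q sub by (intro interiorI[of "{a<..<t}"]) auto
      have "k' \<le> j"
      proof (rule ccontr)
        assume *: "\<not> k' \<le> j"
        then have "P q j = P q l'" "P q (j + 1) = P q l'"
          using n_system_S3[OF sys int kl, of j] n_system_S3[OF sys int kl, of "j + 1"] l' by auto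
        then show False using gap[of q] q by simp
      qed
      then show ?thesis using kl by blast
    qed
    then obtain k' l' where kl: "S2_at n I P q k' l'" "k' \<le> j" by blast
    obtain e where e: "e > 0"
      "\<forall>t j. t \<in> I \<longrightarrow> q \<le> t \<longrightarrow> t \<le> q + e \<longrightarrow> j \<in> {1..n} \<longrightarrow> P t j = P q j + (if j = k' then t - q else 0)"
      using S2_at_right[OF kl(1)] .
    show "\<exists>e>0. \<forall>r. q < r \<and> r \<le> q + e \<and> r \<le> t \<longrightarrow> (\<forall>i\<in>{j + 1..n}. P r i = P a i)"
    proof (intro exI[of _ e] conjI allI impI ballI e(1))
      fix r i assume r: "q < r \<and> r \<le> q + e \<and> r \<le> t" and i: "i \<in> {j + 1..n}"
      have "r \<in> I" using sub r q by auto
      then have "P r i = P q i" using e(2)[rule_format, of r i] r i kl(2) by auto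
      then show "P r i = P a i" using IH[of q] q i by auto
    qed
  next
    fix q assume q: "a < q" "q \<le> t"
      and IH: "\<And>r. a \<le> r \<Longrightarrow> r < q \<Longrightarrow> \<forall>i\<in>{j + 1..n}. P r i = P a i"
    have qI: "q \<in> I" using sub q by auto
    obtain k' l' where kl: "S2_at n I P q k' l'" using n_system_S2[OF sys qI] .
    obtain e where e: "e > 0"
      "\<forall>t j. t \<in> I \<longrightarrow> q - e \<le> t \<longrightarrow> t \<le> q \<longrightarrow> j \<in> {1..n} \<longrightarrow> P t j = P q j + (if j = l' then t - q else 0)"
      using S2_at_left[OF kl] .
    define r where "r = max a (q - e)"
    have r: "a \<le> r" "r < q" "q - e \<le> r" using q e by (auto simp: r_def)
    \<comment> \<open>Two distinct points before \<open>q\<close> on the same affine piece: equal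
      values there exclude slope 1 for the coordinate \<open>i\<close>.\<close>
    define r' where "r' = (r + q) / 2"
    have r': "a \<le> r'" "r' < q" "q - e \<le> r'" "r < r'" using r by (auto simp: r'_def)
    show "\<forall>i\<in>{j + 1..n}. P q i = P a i"
    proof
      fix i assume i: "i \<in> {j + 1..n}"
      have "r \<in> I" "r' \<in> I" using sub r r' q by auto
      then have "P r i = P q i + (if i = l' then r - q else 0)" "P r' i = P q i + (if i = l' then r' - q else 0)"
        using e(2)[rule_format, of r i] e(2)[rule_format, of r' i] r r' i by auto
      moreover have "P r i = P a i" "P r' i = P a i" using IH[of r] IH[of r'] r r' i by auto
      ultimately show "P q i = P a i" using r' by (auto split: if_splits)
    qed
  qed (use q in auto)
  then show ?thesis using i by blast
qed

text \<open>If no growth of coordinate \<open>j\<close> started at the level \<open>P p j\<close>,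
  then by (S2) every time at this level would be followed by a short interval at the same level, and
  by continuity the level would persist up to \<open>t\<close>.\<close>

lemma n_system_growth_start:
  assumes sys: "n_system n I P" and p: "p \<in> I" and t: "t \<in> I" and "p \<le> t" and j: "j \<in> {1..n}"
    and less: "P p j < P t j"
  obtains a l where "p \<le> a" "a < t" "P a j = P p j" "S2_at n I P a j l"
proof -
  have sub: "{p..t} \<subseteq> I" using n_system_subset[OF sys p t] .
  have "\<exists>a l. p \<le> a \<and> a < t \<and> P a j = P p j \<and> S2_at n I P a j l"
  proof (rule ccontr)
    assume no: "\<not> ?thesis"
    have "P t j = P p j"
    proof (rule interval_induct[where Q = "\<lambda>q. P q j = P p j" and a = p and b = t])
      fix q assume q: "p \<le> q" "q < t" and IH: "\<And>r. p \<le> r \<Longrightarrow> r \<le> q \<Longrightarrow> P r j = P p j"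
      have qI: "q \<in> I" using sub q by auto
      obtain k l where kl: "S2_at n I P q k l" using n_system_S2[OF sys qI] .
      have "P q j = P p j" using IH[of q] q by simp
      then have "k \<noteq> j" using no kl q by blast
      obtain e where e: "e > 0"
        "\<forall>t j. t \<in> I \<longrightarrow> q \<le> t \<longrightarrow> t \<le> q + e \<longrightarrow> j \<in> {1..n} \<longrightarrow> P t j = P q j + (if j = k then t - q else 0)"
        using S2_at_right[OF kl] .
      show "\<exists>e>0. \<forall>r. q < r \<and> r \<le> q + e \<and> r \<le> t \<longrightarrow> P r j = P p j"
      proof (intro exI[of _ e] conjI allI impI e(1))
        fix r assume r: "q < r \<and> r \<le> q + e \<and> r \<le> t"
        then have "r \<in> I" using sub q by auto
        then show "P r j = P p j" using e(2)[rule_format, of r j] r j \<open>k \<noteq> j\<close> IH[of q] q by auto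
      qed
    next
      fix q assume q: "p < q" "q \<le> t" and IH: "\<And>r. p \<le> r \<Longrightarrow> r < q \<Longrightarrow> P r j = P p j"
      have sub': "{p..q} \<subseteq> I" using sub q by auto
      have cont: "continuous_on {p..q} (\<lambda>q. P q j)"
        using continuous_on_subset[OF n_system_continuous[OF sys j] sub'] .
      have "closedin (top_of_set {p..q}) {r \<in> {p..q}. P r j = P p j}"
        using continuous_closedin_preimage_constant[OF cont] .
      then have "closed {r \<in> {p..q}. P r j = P p j}"
        by (rule closedin_closed_trans) simp
      moreover have "{p..<q} \<subseteq> {r \<in> {p..q}. P r j = P p j}"
      proof
        fix r assume "r \<in> {p..<q}"
        then show "r \<in> {r \<in> {p..q}. P r j = P p j}" using IH[of r] by simp
      qed
      ultimately have "closure {p..<q} \<subseteq> {r \<in> {p..q}. P r j = P p j}"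
        by (intro closure_minimal)
      moreover have "q \<in> closure {p..<q}" using q by simp
      ultimately show "P q j = P p j" by blast
    qed (use \<open>p \<le> t\<close> in auto)
    then show False using less by simp
  qed
  then show ?thesis using that by blast
qed

section \<open>Estimates with a small error\<close>

lemma eventually_mult_less:
  fixes K c :: real
  assumes "0 < c"
  shows "\<forall>\<^sub>F \<epsilon> in at_right 0. K * \<epsilon> < c"
proof -
  have "((\<lambda>\<epsilon>. K * \<epsilon>) \<longlongrightarrow> K * 0) (at_right 0)" by (intro tendsto_intros)
  then show ?thesis using assms by (intro order_tendstoD(2)) auto
qed

text \<open>In the applications of this and the next estimates \<open>A\<close>, \<open>B\<close>,
  \<open>D\<close> are \<open>\<alpha> - 1\<close>, \<open>\<beta> - 1\<close>,
  \<open>\<beta> - \<alpha>\<close>, and \<open>g\<close> is the gap between P_3 and P_4. As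
  \<open>2 * \<epsilon> < B\<close> absorbs the error in \<open>size\<close>, the hypotheses bound
  \<open>t\<close> by a multiple of \<open>d\<close>, so errors of order
  \<open>\<epsilon> * t\<close> are small against \<open>d\<close>.\<close>

lemma no_start_estimate:
  fixes A B D \<beta> :: real
  assumes pos: "0 < A" "0 < B" "0 < D" "0 < \<beta>"
  shows "\<forall>\<^sub>F \<epsilon> in at_right 0. \<forall>t u d g. 0 < t \<longrightarrow> d \<le> t \<longrightarrow> 2 * A * u \<le> D * d \<longrightarrow>
    B * g \<le> A * u + \<epsilon> * t \<longrightarrow> B * t = 4 * u + (1 + 3 * \<beta>) * d + B * g \<longrightarrow>
    \<epsilon> * (2 * t + d) < A * \<beta> * d"
proof -
  define K where "K = (4 + A) * D + 2 * A * (1 + 3 * \<beta>)"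
  have K: "0 < K" using pos by (simp add: K_def add_pos_pos)
  have "\<forall>\<^sub>F \<epsilon> in at_right 0. 2 * \<epsilon> < B" "\<forall>\<^sub>F \<epsilon> in at_right 0. (3 * K) * \<epsilon> < A * A * B * \<beta>"
    using pos by (auto intro!: eventually_mult_less)
  moreover have "\<forall>\<^sub>F \<epsilon> in at_right 0. \<epsilon> > (0::real)"
    using eventually_at_right_less by blast
  ultimately show ?thesis
  proof eventually_elim
    case (elim \<epsilon>)
    show ?case
    proof (intro allI impI)
      fix t u d g
      assume t: "0 < t" "d \<le> t" and u: "2 * A * u \<le> D * d" and g: "B * g \<le> A * u + \<epsilon> * t"
        and size: "B * t = 4 * u + (1 + 3 * \<beta>) * d + B * g"
      have "B * t \<le> (4 + A) * u + (1 + 3 * \<beta>) * d + \<epsilon> * t"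
        using size g by (simp add: algebra_simps)
      moreover have "\<epsilon> * t \<le> B / 2 * t" using elim t by (intro mult_right_mono) auto
      ultimately have "B / 2 * t \<le> (4 + A) * u + (1 + 3 * \<beta>) * d" by (simp add: field_simps)
      then have "2 * A * (B / 2 * t) \<le> 2 * A * ((4 + A) * u + (1 + 3 * \<beta>) * d)"
        using pos by (intro mult_left_mono) auto
      moreover have "(4 + A) * (2 * A * u) \<le> (4 + A) * (D * d)"
        using pos u by (intro mult_left_mono) auto
      ultimately have 1: "A * B * t \<le> K * d" by (simp add: K_def algebra_simps)
      have "K * (\<epsilon> * (2 * t + d)) \<le> K * (\<epsilon> * (3 * t))"
        using K elim t by (intro mult_left_mono) auto
      also have "\<dots> = 3 * K * \<epsilon> * t" by simp
      also have "\<dots> < A * A * B * \<beta> * t" using elim t by (intro mult_strict_right_mono) auto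
      also have "\<dots> = (A * \<beta>) * (A * B * t)" by simp
      also have "\<dots> \<le> (A * \<beta>) * (K * d)" using pos 1 by (intro mult_left_mono) auto
      finally have "K * (\<epsilon> * (2 * t + d)) < K * (A * \<beta> * d)" by (simp add: mult_ac)
      then show "\<epsilon> * (2 * t + d) < A * \<beta> * d" using K by simp
    qed
  qed
qed

text \<open>
  For \<open>\<epsilon> = 0\<close> this says that \<open>r' \<le> \<alpha> r / (\<beta> - (\<beta> - 1) (\<alpha> - 1) r)\<close>, where \<open>r = u / ((\<beta> - 1) d)\<close>: the
  right-hand side has the fixed point \<open>(\<beta> - \<alpha>) / ((\<beta> - 1) (\<alpha> - 1))\<close>, and the inequality
  \<open>2 (\<alpha> - 1) u \<le> (\<beta> - \<alpha>) d\<close> amounts to \<open>r\<close> being at most one half of it.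
\<close>

lemma step_estimate:
  fixes \<alpha> \<beta> A B D :: real
  assumes "1 < \<alpha>" "\<alpha> < \<beta>" and AB: "A = \<alpha> - 1" "B = \<beta> - 1" "D = \<beta> - \<alpha>"
  shows "\<forall>\<^sub>F \<epsilon> in at_right 0. \<forall>t u d u' d' g'. 0 < t \<longrightarrow> 0 \<le> d \<longrightarrow> 2 * A * u \<le> D * d \<longrightarrow>
    u + \<beta> * d \<le> u' + d' \<longrightarrow> B * g' \<le> \<alpha> * A * u + \<epsilon> * t \<longrightarrow> \<bar>B * g' - A * u'\<bar> \<le> \<epsilon> * t \<longrightarrow>
    B * t = 4 * u' + (1 + 3 * \<beta>) * d' + B * g' \<longrightarrow> 2 * A * u' \<le> D * d'"
proof -
  have pos: "0 < A" "0 < B" "0 < D" using assms by auto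
  \<comment> \<open>\<open>K\<close> is the coefficient of \<open>u'\<close> once
    \<open>D * d'\<close> has been replaced by \<open>2 * A * u'\<close> in \<open>D\<close> times
    the right-hand side of \<open>size\<close>.\<close>
  define K where "K = (4 + A) * D + 2 * A * (1 + 3 * \<beta>)"
  have K: "0 < K" using pos assms by (simp add: K_def add_pos_pos)
  have "\<forall>\<^sub>F \<epsilon> in at_right 0. 2 * \<epsilon> < B" "\<forall>\<^sub>F \<epsilon> in at_right 0. (8 * K) * \<epsilon> < A * D * B"
    "\<forall>\<^sub>F \<epsilon> in at_right 0. (8 * (2 * A + D) * K * \<alpha>) * \<epsilon> < A * A * B * D * D"
    using pos by (auto intro!: eventually_mult_less)
  moreover have "\<forall>\<^sub>F \<epsilon> in at_right 0. \<epsilon> > (0::real)"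
    using eventually_at_right_less by blast
  ultimately show ?thesis
  proof eventually_elim
    case (elim \<epsilon>)
    show ?case
    proof (intro allI impI, rule ccontr)
      fix t u d u' d' g'
      assume t: "0 < t" and d: "0 \<le> d" and u: "2 * A * u \<le> D * d" and x1: "u + \<beta> * d \<le> u' + d'"
        and g: "B * g' \<le> \<alpha> * A * u + \<epsilon> * t" and g': "\<bar>B * g' - A * u'\<bar> \<le> \<epsilon> * t"
        and size: "B * t = 4 * u' + (1 + 3 * \<beta>) * d' + B * g'"
        and "\<not> 2 * A * u' \<le> D * d'"
      \<comment> \<open>Under the contrary assumption \<open>size\<close> bounds \<open>t\<close> by
        \<open>u'\<close>, then \<open>Au'\<close> bounds it by \<open>u\<close>, and the hypothesis
        on \<open>u\<close> bounds it by \<open>d\<close>. All errors can then be compared with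
        \<open>d\<close>.\<close>
      then have u': "D * d' < 2 * A * u'" by simp
      have Au': "A * u' \<le> \<alpha> * A * u + 2 * \<epsilon> * t" using g g' by linarith
      have "B * t \<le> (4 + A) * u' + (1 + 3 * \<beta>) * d' + \<epsilon> * t"
        using size g' by (simp add: algebra_simps)
      moreover have "\<epsilon> * t \<le> B / 2 * t" using elim t by (intro mult_right_mono) auto
      ultimately have "B / 2 * t \<le> (4 + A) * u' + (1 + 3 * \<beta>) * d'" by (simp add: field_simps)
      then have "D * (B / 2 * t) \<le> D * ((4 + A) * u' + (1 + 3 * \<beta>) * d')"
        using pos by (intro mult_left_mono) auto
      moreover have "(1 + 3 * \<beta>) * (D * d') \<le> (1 + 3 * \<beta>) * (2 * A * u')"
        using u' assms by (intro mult_left_mono) auto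
      ultimately have "D * B / 2 * t \<le> K * u'" by (simp add: K_def algebra_simps)
      then have "A * (D * B / 2 * t) \<le> A * (K * u')" using pos by (intro mult_left_mono) auto
      moreover have "K * (A * u') \<le> K * (\<alpha> * A * u + 2 * \<epsilon> * t)"
        using Au' K by (intro mult_left_mono) auto
      moreover have "8 * K * \<epsilon> * t \<le> A * D * B * t" using elim t by (intro mult_right_mono) auto
      ultimately have "A * D * B * t \<le> 2 * (K * \<alpha>) * (2 * A * u)" by (simp add: algebra_simps)
      also have "\<dots> \<le> 2 * (K * \<alpha>) * (D * d)" using K u assms by (intro mult_left_mono) auto
      finally have "D * (A * B * t) \<le> D * (2 * K * \<alpha> * d)" by (simp add: mult_ac)
      then have t_le: "A * B * t \<le> 2 * K * \<alpha> * d" using pos by simp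

      \<comment> \<open>Without errors the resulting inequality fails by
        \<open>A * D * D * d\<close>; \<open>t_le\<close> shows that the errors cannot make up for
        this.\<close>
      have "D * (u + \<beta> * d) \<le> D * (u' + d')" using pos x1 by (intro mult_left_mono) auto
      then have "D * (u + \<beta> * d) < (2 * A + D) * u'" using u' by (simp add: algebra_simps)
      then have "A * (D * (u + \<beta> * d)) < A * ((2 * A + D) * u')" using pos by simp
      moreover have "(2 * A + D) * (A * u') \<le> (2 * A + D) * (\<alpha> * A * u + 2 * \<epsilon> * t)"
        using Au' pos by (intro mult_left_mono) auto
      ultimately have "A * (D * (u + \<beta> * d)) < (2 * A + D) * (\<alpha> * A * u + 2 * \<epsilon> * t)"
        by (simp add: algebra_simps)
      moreover have "A * (2 * \<alpha> + D) * (2 * A * u) \<le> A * (2 * \<alpha> + D) * (D * d)"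
        using u pos assms by (intro mult_left_mono) auto
      moreover have "(2 * A + D) * (\<alpha> * A * u) - A * (D * u) = A * A * u * (2 * \<alpha> + D)"
        unfolding AB by (simp add: algebra_simps)
      moreover have "2 * (A * (D * (\<beta> * d))) - A * (2 * \<alpha> + D) * (D * d) = A * D * D * d"
        unfolding AB by (simp add: algebra_simps)
      ultimately have "A * D * D * d < 4 * (2 * A + D) * \<epsilon> * t" by (simp add: algebra_simps)
      then have "(A * B) * (A * D * D * d) < (A * B) * (4 * (2 * A + D) * \<epsilon> * t)"
        using pos by simp
      also have "\<dots> = (4 * (2 * A + D) * \<epsilon>) * (A * B * t)" by simp
      also have "\<dots> \<le> (4 * (2 * A + D) * \<epsilon>) * (2 * K * \<alpha> * d)"
        using t_le pos elim by (intro mult_left_mono) auto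
      also have "\<dots> = 8 * (2 * A + D) * K * \<alpha> * \<epsilon> * d" by simp
      also have "\<dots> \<le> (A * A * B * D * D) * d" using elim d by (intro mult_right_mono) auto
      finally show False by (simp add: mult_ac)
    qed
  qed
qed

text \<open>If \<open>u\<close> is at most of order \<open>\<epsilon> * t\<close>, then so is
  \<open>B * g\<close>, and the term with \<open>d\<close> must carry at least half of
  \<open>B * t\<close>. Thus \<open>t\<close> is bounded by a multiple of \<open>d\<close>, and
  \<open>u\<close> is at most a small multiple of \<open>d\<close>.\<close>

lemma start_estimate:
  fixes A B D \<beta> K :: real
  assumes pos: "0 < A" "0 < B" "0 < D" "0 < \<beta>"
  shows "\<forall>\<^sub>F \<epsilon> in at_right 0. \<forall>t u d g. 0 < t \<longrightarrow> 0 \<le> d \<longrightarrow> A * u \<le> K * \<epsilon> * t \<longrightarrow>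
    B * g \<le> A * u + \<epsilon> * t \<longrightarrow> B * t = 4 * u + (1 + 3 * \<beta>) * d + B * g \<longrightarrow> 2 * A * u \<le> D * d"
proof -
  have "\<forall>\<^sub>F \<epsilon> in at_right 0. (2 * ((4 + A) * K + A)) * \<epsilon> < A * B"
    "\<forall>\<^sub>F \<epsilon> in at_right 0. (4 * \<bar>K\<bar> * (1 + 3 * \<beta>)) * \<epsilon> < B * D"
    using pos by (auto intro!: eventually_mult_less)
  moreover have "\<forall>\<^sub>F \<epsilon> in at_right 0. \<epsilon> > (0::real)"
    using eventually_at_right_less by blast
  ultimately show ?thesis
  proof eventually_elim
    case (elim \<epsilon>)
    show ?case
    proof (intro allI impI)
      fix t u d g
      assume t: "0 < t" and d: "0 \<le> d" and u: "A * u \<le> K * \<epsilon> * t" and g: "B * g \<le> A * u + \<epsilon> * t"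
        and size: "B * t = 4 * u + (1 + 3 * \<beta>) * d + B * g"
      have "A * (B * t) = 4 * (A * u) + A * (1 + 3 * \<beta>) * d + A * (B * g)"
        unfolding size by (simp add: algebra_simps)
      moreover have "A * (B * g) \<le> A * (A * u + \<epsilon> * t)" using g pos by (intro mult_left_mono) auto
      moreover have "(4 + A) * (A * u) \<le> (4 + A) * (K * \<epsilon> * t)"
        using u pos by (intro mult_left_mono) auto
      moreover have "2 * ((4 + A) * K + A) * \<epsilon> * t \<le> A * B * t"
        using elim t by (intro mult_right_mono) auto
      ultimately have "A * (B * t) \<le> A * (2 * (1 + 3 * \<beta>) * d)" by (simp add: algebra_simps)
      then have t_le: "B * t \<le> 2 * (1 + 3 * \<beta>) * d" using pos by simp
      \<comment> \<open>\<open>K\<close> may be negative, and the multiplication below needs a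
        nonnegative factor.\<close>
      have "A * u \<le> \<bar>K\<bar> * \<epsilon> * t"
        using u t elim by (smt (verit) mult_right_mono abs_ge_self)
      then have "B * (2 * (A * u)) \<le> B * (2 * (\<bar>K\<bar> * \<epsilon> * t))" using pos by simp
      also have "\<dots> = 2 * \<bar>K\<bar> * \<epsilon> * (B * t)" by simp
      also have "\<dots> \<le> 2 * \<bar>K\<bar> * \<epsilon> * (2 * (1 + 3 * \<beta>) * d)" using t_le elim by (intro mult_left_mono) auto
      also have "\<dots> = 4 * \<bar>K\<bar> * (1 + 3 * \<beta>) * \<epsilon> * d" by simp
      also have "\<dots> \<le> B * D * d" using elim d by (intro mult_right_mono) auto
      finally show "2 * A * u \<le> D * d" using pos by simp
    qed
  qed
qed

text \<open>\<open>c\<close> is the ratio of x_4 - x_3 to the coordinate sum at the third division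
  point of R. Without errors a gap \<open>g \<ge> c * t\<close> would force \<open>d = 0\<close>,
  hence \<open>u \<le> 0\<close> and then \<open>g \<le> 0\<close>; with errors the same chain holds
  up to order \<open>\<epsilon> * t\<close>.\<close>

lemma extremal_estimate:
  fixes \<alpha> A B D \<beta> c :: real
  assumes pos: "0 < A" "0 < B" "0 < D" "0 < \<beta>" "0 < \<alpha>"
    and A: "A = \<alpha> - 1" and c: "c = \<alpha> * A / (2 + \<alpha> + \<alpha>\<^sup>2)"
  shows "\<forall>\<^sub>F \<epsilon> in at_right 0. \<forall>t x u d g. 0 < t \<longrightarrow> 0 \<le> d \<longrightarrow> 2 * A * u \<le> D * d \<longrightarrow>
    B * g \<le> \<alpha> * A * u + \<epsilon> * t \<longrightarrow> B * g + A * \<beta> * d \<le> A * B * x + \<epsilon> * t \<longrightarrow>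
    B * t = 2 * u + (1 + \<beta>) * d + 2 * B * x + B * g \<longrightarrow> g < (c - \<epsilon>) * t"
proof -
  define C where "C = 2 + \<alpha> + \<alpha>\<^sup>2"
  have C: "0 < C" using pos by (simp add: C_def add_pos_pos)
  have "0 < c" unfolding c using pos C by (simp add: C_def)
  define K where "K = C * B + 2 + 2 * \<alpha>"
  have "\<forall>\<^sub>F \<epsilon> in at_right 0. (\<alpha> * D * K + 2 * \<alpha> * A * (1 + \<beta>) * (B + 1)) * \<epsilon> < 2 * \<alpha> * A * (1 + \<beta>) * (B * c)"
    using pos \<open>0 < c\<close> by (intro eventually_mult_less) auto
  moreover have "\<forall>\<^sub>F \<epsilon> in at_right 0. \<epsilon> > (0::real)"
    using eventually_at_right_less by blast
  ultimately show ?thesis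
  proof eventually_elim
    case (elim \<epsilon>)
    show ?case
    proof (intro allI impI, rule ccontr)
      fix t x u d g
      assume t: "0 < t" and d: "0 \<le> d" and u: "2 * A * u \<le> D * d" 
        and g: "B * g \<le> \<alpha> * A * u + \<epsilon> * t" and x: "B * g + A * \<beta> * d \<le> A * B * x + \<epsilon> * t"
        and size: "B * t = 2 * u + (1 + \<beta>) * d + 2 * B * x + B * g" and "\<not> g < (c - \<epsilon>) * t"
      have Cc: "C * c = \<alpha> * A" using C unfolding c C_def by simp
      from \<open>\<not> g < (c - \<epsilon>) * t\<close> have g_ge: "(c - \<epsilon>) * t \<le> g" by simp
      have "0 \<le> A * \<beta> * d" using pos d by simp
      then have x': "B * g \<le> A * B * x + \<epsilon> * t" using x by linarith
      \<comment> \<open>Each of \<open>\<alpha> * A * u\<close> and \<open>A * B * x\<close> is at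
        least \<open>B * g\<close> up to \<open>\<epsilon> * t\<close>, so the multiples of
        \<open>B * g\<close> add up to \<open>2 + 2 * \<alpha> + \<alpha> * A = C\<close>, and what
        remains bounds \<open>d\<close>.\<close>
      have "\<alpha> * A * (B * t) = 2 * (\<alpha> * A * u) + \<alpha> * A * (1 + \<beta>) * d + 2 * \<alpha> * (A * B * x) + \<alpha> * A * (B * g)"
        unfolding size by (simp add: algebra_simps)
      moreover have "\<alpha> * (B * g) \<le> \<alpha> * (A * B * x + \<epsilon> * t)" using x' pos by (intro mult_left_mono) auto
      ultimately have "C * (B * g) + \<alpha> * A * (1 + \<beta>) * d \<le> \<alpha> * A * (B * t) + (2 + 2 * \<alpha>) * \<epsilon> * t"
        using g unfolding C_def A by (simp add: algebra_simps power2_eq_square)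
      moreover have "(C * c) * (B * t) - C * B * \<epsilon> * t \<le> C * (B * g)"
        using mult_left_mono[OF g_ge, of "C * B"] C pos by (simp add: algebra_simps)
      ultimately have d_le: "\<alpha> * A * (1 + \<beta>) * d \<le> K * \<epsilon> * t"
        unfolding Cc K_def by (simp add: algebra_simps)
      have "B * ((c - \<epsilon>) * t) \<le> B * g" using g_ge pos by (intro mult_left_mono) auto
      then have "(B * c - (B + 1) * \<epsilon>) * t \<le> \<alpha> * (A * u)" using g by (simp add: algebra_simps)
      then have "2 * A * (1 + \<beta>) * ((B * c - (B + 1) * \<epsilon>) * t) \<le> 2 * A * (1 + \<beta>) * (\<alpha> * (A * u))"
        using pos by (intro mult_left_mono) auto
      also have "\<dots> = \<alpha> * A * (1 + \<beta>) * (2 * A * u)" by simp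
      also have "\<dots> \<le> \<alpha> * A * (1 + \<beta>) * (D * d)" using pos u by (intro mult_left_mono) auto
      also have "\<dots> = D * (\<alpha> * A * (1 + \<beta>) * d)" by simp
      also have "\<dots> \<le> D * (K * \<epsilon> * t)" using pos d_le by (intro mult_left_mono) auto
      finally have "2 * A * (1 + \<beta>) * (B * c - (B + 1) * \<epsilon>) * t \<le> D * K * \<epsilon> * t" by (simp add: mult_ac)
      then have "2 * A * (1 + \<beta>) * (B * c - (B + 1) * \<epsilon>) \<le> D * K * \<epsilon>" using t by simp
      then have "\<alpha> * (2 * A * (1 + \<beta>) * (B * c - (B + 1) * \<epsilon>)) \<le> \<alpha> * (D * K * \<epsilon>)"
        using pos by simp
      then show False using elim by (simp add: algebra_simps)
    qed
  qed
qed

section \<open>The dynamics of a system close to the cone\<close>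

lemma T_map_simps:
  "T_map \<alpha> \<beta> x 1 = (\<beta> - 1) * (x 4 - x 2) - (\<alpha> - 1) * (\<beta> * x 1 - x 2)"
  "T_map \<alpha> \<beta> x 2 = \<alpha> * (\<beta> - 1) * x 3 - (\<beta> - 1) * x 4 - (\<alpha> - 1) * \<beta> * (x 2 - x 1)"
  "T_map \<alpha> \<beta> x 3 = \<alpha> * (\<alpha> - 1) * (\<beta> * x 1 - x 2) - (\<beta> - 1) * (x 4 - x 3)"
  "T_map \<alpha> \<beta> x 4 = x 3 - x 4"
  "T_map \<alpha> \<beta> x 5 = x 4 - x 2"
  by (simp_all add: T_map_def point_def algebra_simps)

locale proper_4_system =
  fixes \<alpha> \<beta> q0 :: real and P :: "real \<Rightarrow> nat \<Rightarrow> real"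
  assumes \<alpha>: "1 < \<alpha>" and \<beta>: "\<alpha> < \<beta>" and proper: "proper_n_system 4 q0 P"
begin

lemma system: "n_system 4 {q0..} P" and q0_nonneg: "0 \<le> q0"
  using proper by (auto simp: proper_n_system_def)

lemma ordered:
  assumes "q0 \<le> q"
  shows "0 \<le> P q 1" "P q 1 \<le> P q 2" "P q 2 \<le> P q 3" "P q 3 \<le> P q 4"
    "P q 1 + P q 2 + P q 3 + P q 4 = q"
proof -
  have "P q 1 \<le> P q 2"
    using n_system_S1(2)[OF system, of q 1] assms by (simp add: numeral_2_eq_2)
  moreover have "{1..4} = {1, 2, 3, 4 :: nat}" by auto
  ultimately show "0 \<le> P q 1" "P q 1 \<le> P q 2" "P q 2 \<le> P q 3" "P q 3 \<le> P q 4"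
    "P q 1 + P q 2 + P q 3 + P q 4 = q"
    using n_system_S1(1,3)[OF system, of q]
      n_system_S1(2)[OF system, of q 2] n_system_S1(2)[OF system, of q 3] assms by simp_all
qed

lemma mono: "\<lbrakk>q0 \<le> a; a \<le> b; j \<in> {1..4}\<rbrakk> \<Longrightarrow> P a j \<le> P b j"
  using n_system_mono[OF system] by simp

lemma continuous: "j \<in> {1..4} \<Longrightarrow> continuous_on {q0..} (\<lambda>q. P q j)"
  using n_system_continuous[OF system] .

section \<open>The quantities U, d and V and their change along a system\<close>

definition U :: "real \<Rightarrow> real" where "U q = \<beta> * P q 1 - P q 2"
definition d :: "real \<Rightarrow> real" where "d q = P q 2 - P q 1"
text \<open>\<open>V q \<le> 0\<close> says, without division by \<open>d q\<close>, that the ratio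
  of \<open>U q\<close> to \<open>d q\<close> is at most half of
  \<open>(\<beta> - \<alpha>) / (\<alpha> - 1)\<close>, the repelling fixed point of the error-free
  step.\<close>

definition V :: "real \<Rightarrow> real" where "V q = 2 * (\<alpha> - 1) * U q - (\<beta> - \<alpha>) * d q"

text \<open>As long as P_1 rests, growth of P_2 lowers \<open>U\<close> and raises
  \<open>d\<close>.\<close>

lemma V_le:
  assumes "q0 \<le> p" "p \<le> a" "P a 1 = P p 1"
  shows "U a \<le> U p" "V a \<le> V p"
proof -
  have "P p 2 \<le> P a 2" using mono[of p a 2] assms by simp
  then show U: "U a \<le> U p" using assms by (simp add: U_def)
  have "d p \<le> d a" using \<open>P p 2 \<le> P a 2\<close> assms by (simp add: d_def)
  then have "2 * (\<alpha> - 1) * U a \<le> 2 * (\<alpha> - 1) * U p" "(\<beta> - \<alpha>) * d p \<le> (\<beta> - \<alpha>) * d a"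
    using U \<alpha> \<beta> by (auto intro: mult_left_mono)
  then show "V a \<le> V p" unfolding V_def by linarith
qed

text \<open>The coefficients come from \<open>(\<beta> - 1) * P q 1 = U q + d q\<close> and
  \<open>(\<beta> - 1) * P q 2 = U q + \<beta> * d q\<close>.\<close>

lemma size_split: "q0 \<le> q \<Longrightarrow> (\<beta> - 1) * q
    = 2 * U q + (1 + \<beta>) * d q + 2 * (\<beta> - 1) * P q 3 + (\<beta> - 1) * (P q 4 - P q 3)"
  by (subst (1) ordered(5)[of q, symmetric]) (simp_all add: U_def d_def algebra_simps)

lemma growth_start:
  assumes "q0 \<le> p" "p \<le> t" "P p 1 < P t 1"
  obtains a l where "p \<le> a" "a < t" "P a 1 = P p 1" "S2_at 4 {q0..} P a 1 l"
  using n_system_growth_start[OF system, of p t 1] assms by auto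

lemma upper_const:
  assumes "q0 \<le> a" "S2_at 4 {q0..} P a 1 l" "a \<le> t"
    and "\<And>q. a \<le> q \<Longrightarrow> q < t \<Longrightarrow> P q 2 < P q 3"
  shows "P t 3 = P a 3" "P t 4 = P a 4"
  using n_system_upper_const[OF system, of a t 2 1 l t 3] n_system_upper_const[OF system, of a t 2 1 l t 4]
    assms by auto

text \<open>Were P_1 to stay below the old value of P_2, it would stay strictly below P_2 itself, so
  P_2 and P_3 would keep their values from \<open>a\<close> and could not meet at
  \<open>t\<close>.\<close>

lemma first_catches_second:
  assumes a: "q0 \<le> a" "S2_at 4 {q0..} P a 1 l" "P a 2 < P a 3" and t: "a \<le> t" "P t 2 = P t 3"
  shows "P a 2 \<le> P t 1"
proof (rule ccontr)
  assume *: "\<not> P a 2 \<le> P t 1"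
  have "P q 1 < P q 2" if "a \<le> q" "q < t" for q
    using mono[of q t 1] mono[of a q 2] that a t * by simp
  then have "P t 2 = P a 2" "P t 3 = P a 3"
    using n_system_upper_const[OF system, of a t 1 1 l t 2]
      n_system_upper_const[OF system, of a t 1 1 l t 3] a t by (auto simp: numeral_2_eq_2)
  then show False using a t by simp
qed

text \<open>Before time \<open>t\<close> the total growth since \<open>a\<close> is less than
  \<open>d a\<close>, so P_1 cannot have reached P_2; by (S3) it is then the only coordinate that
  grows.\<close>

lemma first_grows_to_second:
  assumes a: "q0 \<le> a" "S2_at 4 {q0..} P a 1 l" and t: "t = a + d a"
  shows "P t 1 = P a 2" "P t 2 = P a 2" "P t 4 = P a 4"
proof -
  have "a \<le> t" using ordered[of a] a t by (simp add: d_def)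
  have "P q 1 < P q 2" if "a \<le> q" "q < t" for q
    using mono[of a q 2] mono[of a q 3] mono[of a q 4] ordered(5)[of a] ordered(5)[of q] that a t
    unfolding d_def by simp
  then have "P t 2 = P a 2" "P t 3 = P a 3" "P t 4 = P a 4"
    using n_system_upper_const[OF system, of a t 1 1 l t 2]
      n_system_upper_const[OF system, of a t 1 1 l t 3]
      n_system_upper_const[OF system, of a t 1 1 l t 4] a \<open>a \<le> t\<close> by (auto simp: numeral_2_eq_2)
  then show "P t 1 = P a 2" "P t 2 = P a 2" "P t 4 = P a 4"
    using ordered(5)[of a] ordered(5)[of t] a t \<open>a \<le> t\<close> unfolding d_def by simp_all
qed

section \<open>Times at which P_2 and P_3 meet\<close>

lemma compact_touch: "q0 \<le> s \<Longrightarrow> compact {q \<in> {s..t}. P q 2 = P q 3}"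
proof -
  assume s: "q0 \<le> s"
  have "continuous_on {s..t} (\<lambda>q. P q 2 - P q 3)"
    using s by (intro continuous_intros continuous_on_subset[OF continuous]) auto
  then have "closed {q \<in> {s..t}. P q 2 - P q 3 = 0}"
    by (intro continuous_closed_preimage_constant) auto
  then have "closed {q \<in> {s..t}. P q 2 = P q 3}" by simp
  moreover have "bounded {q \<in> {s..t}. P q 2 = P q 3}"
    by (rule bounded_subset[OF bounded_closed_interval[of s t]]) auto
  ultimately show ?thesis by (simp add: compact_eq_bounded_closed)
qed

lemma first_touch:
  assumes s: "q0 \<le> s" and "s \<le> t" "P t 2 = P t 3"
  obtains t' where "s \<le> t'" "t' \<le> t" "P t' 2 = P t' 3"
    "\<And>q. s \<le> q \<Longrightarrow> q < t' \<Longrightarrow> P q 2 < P q 3"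
proof -
  define X where "X = {q \<in> {s..t}. P q 2 = P q 3}"
  have "compact X" "X \<noteq> {}" using compact_touch[OF s, of t] assms by (auto simp: X_def)
  then obtain t' where t': "t' \<in> X" "\<forall>q\<in>X. t' \<le> q" using compact_attains_inf by blast
  show thesis
  proof (rule that[of t'])
    fix q assume q: "s \<le> q" "q < t'"
    then have "q \<notin> X" using t'(2) by force
    moreover have "P q 2 \<le> P q 3" using ordered[of q] q s by simp
    ultimately show "P q 2 < P q 3" using q t'(1) by (auto simp: X_def)
  qed (use t'(1) in \<open>auto simp: X_def\<close>)
qed

text \<open>By continuity of \<open>V\<close> the meeting times with \<open>V \<le> 0\<close> form a
  compact set. Its last element allows a later failure of \<open>V \<le> 0\<close> to be traced to a
  single passage between meeting times.\<close>

lemma last_touch_V: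
  assumes s: "q0 \<le> s" and "s \<le> t" "P s 2 = P s 3" "V s \<le> 0"
  obtains p where "s \<le> p" "p \<le> t" "P p 2 = P p 3" "V p \<le> 0"
    "\<And>q. p < q \<Longrightarrow> q \<le> t \<Longrightarrow> P q 2 = P q 3 \<Longrightarrow> 0 < V q"
proof -
  define X where "X = {q \<in> {s..t}. P q 2 = P q 3} \<inter> {q \<in> {s..t}. V q \<le> 0}"
  have "continuous_on {s..t} V"
    unfolding V_def U_def d_def
    using s by (intro continuous_intros continuous_on_subset[OF continuous]) auto
  then have "closed {q \<in> {s..t}. V q \<le> 0}"
    by (intro continuous_on_closed_Collect_le) (auto intro!: continuous_intros)
  then have "compact X" unfolding X_def using compact_touch[OF s] by (intro compact_Int_closed)
  moreover have "s \<in> X" using assms by (auto simp: X_def)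
  ultimately obtain p where p: "p \<in> X" "\<forall>q\<in>X. q \<le> p" using compact_attains_sup[of X] by blast
  show thesis
  proof (rule that[of p])
    fix q assume q: "p < q" "q \<le> t" "P q 2 = P q 3"
    then have "q \<notin> X" using p(2) by force
    then show "0 < V q" using q p(1) by (auto simp: X_def)
  qed (use p(1) in \<open>auto simp: X_def\<close>)
qed

text \<open>Otherwise \<open>P\<^sub>3\<close> and \<open>P\<^sub>4\<close> stop growing for good once \<open>P\<^sub>1\<close> grows, and then \<open>P\<^sub>1\<close> is bounded.\<close>

lemma touch_exists:
  assumes s: "q0 \<le> s"
  obtains t where "s \<le> t" "P t 2 = P t 3"
proof -
  have "\<exists>t\<ge>s. P t 2 = P t 3"
  proof (rule ccontr)
    assume no: "\<not> ?thesis"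
    have gap: "P q 2 < P q 3" if "s \<le> q" for q
      using no that ordered[of q] s by force
    have lim: "filterlim (\<lambda>q. P q 1) at_top at_top" using proper by (simp add: proper_n_system_def)
    obtain t1 where t1: "s \<le> t1" "P s 1 < P t1 1"
      using eventually_conj[OF filterlim_at_top_dense[THEN iffD1, OF lim, rule_format, of "P s 1"]
        eventually_ge_at_top[of s]] by (auto dest!: eventually_happens)
    obtain a l where a: "s \<le> a" "S2_at 4 {q0..} P a 1 l"
      using growth_start[OF s t1] by blast
    obtain t where t: "a \<le> t" "P a 3 < P t 1"
      using eventually_conj[OF filterlim_at_top_dense[THEN iffD1, OF lim, rule_format, of "P a 3"]
        eventually_ge_at_top[of a]] by (auto dest!: eventually_happens)
    have "P t 3 = P a 3" using upper_const[OF _ a(2) t(1)] gap a s by force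
    then show False using ordered[of t] t a s by simp
  qed
  then show thesis using that by blast
qed

text \<open>Nonnegative lower limits of T_1, T_2, T_3 give this property for every
  \<open>\<epsilon> > 0\<close> and all large \<open>Q\<close>. The error is proportional to
  \<open>q\<close> because the lower limits are taken after division by \<open>q\<close>.\<close>

definition near_cone :: "real \<Rightarrow> real \<Rightarrow> bool" where
  "near_cone \<epsilon> Q \<longleftrightarrow> q0 \<le> Q \<and> 0 < Q \<and> 0 < \<epsilon> \<and> (\<forall>q\<ge>Q. \<forall>i\<in>{1, 2, 3}. - \<epsilon> * q \<le> T_map \<alpha> \<beta> (P q) i)"

lemma near_coneD:
  assumes "near_cone \<epsilon> Q" "Q \<le> q"
  shows "(\<alpha> - 1) * U q \<le> (\<beta> - 1) * (P q 4 - P q 2) + \<epsilon> * q"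
    "(\<beta> - 1) * (P q 4 - P q 3) + (\<alpha> - 1) * \<beta> * d q \<le> (\<alpha> - 1) * (\<beta> - 1) * P q 3 + \<epsilon> * q"
    "(\<beta> - 1) * (P q 4 - P q 3) \<le> \<alpha> * (\<alpha> - 1) * U q + \<epsilon> * q"
  using assms T_map_simps(1)[of \<alpha> \<beta> "P q"] T_map_simps(2)[of \<alpha> \<beta> "P q"] T_map_simps(3)[of \<alpha> \<beta> "P q"]
  unfolding near_cone_def U_def d_def by (force simp: algebra_simps)+

text \<open>\<open>T\<^sub>1 + T\<^sub>2\<close> is a multiple of \<open>x\<^sub>3 - x\<^sub>2\<close>, so both almost vanish when \<open>P\<^sub>2 = P\<^sub>3\<close>.\<close>

lemma touch_bounds:
  assumes "near_cone \<epsilon> Q" "Q \<le> t" "P t 2 = P t 3"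
  shows "\<bar>(\<beta> - 1) * (P t 4 - P t 3) - (\<alpha> - 1) * U t\<bar> \<le> \<epsilon> * t"
    "(\<beta> - 1) * t = 4 * U t + (1 + 3 * \<beta>) * d t + (\<beta> - 1) * (P t 4 - P t 3)"
proof -
  have "(\<alpha> - 1) * (\<beta> - 1) * P t 3 - (\<alpha> - 1) * \<beta> * d t = (\<alpha> - 1) * U t"
    using assms(3) unfolding U_def d_def by (simp add: algebra_simps)
  then show "\<bar>(\<beta> - 1) * (P t 4 - P t 3) - (\<alpha> - 1) * U t\<bar> \<le> \<epsilon> * t"
    using near_coneD[OF assms(1,2)] assms(3) by auto
  show "(\<beta> - 1) * t = 4 * U t + (1 + 3 * \<beta>) * d t + (\<beta> - 1) * (P t 4 - P t 3)"
    using size_split[of t] assms unfolding near_cone_def U_def d_def by (simp add: algebra_simps)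
qed

text \<open>At a meeting time T_1 is nearly zero. If P_1 started to grow there, it would rise to P_2
  with P_2 and P_4 fixed, and T_1 would drop by \<open>(\<alpha> - 1) * \<beta> * d a\<close>, more
  than the errors near the cone allow.\<close>

lemma no_growth_at_touch:
  "\<forall>\<^sub>F \<epsilon> in at_right 0. \<forall>Q a l. near_cone \<epsilon> Q \<longrightarrow> Q \<le> a \<longrightarrow> V a \<le> 0 \<longrightarrow>
     S2_at 4 {q0..} P a 1 l \<longrightarrow> P a 2 < P a 3"
proof -
  have "\<forall>\<^sub>F \<epsilon> in at_right 0. \<forall>t u d g. 0 < t \<longrightarrow> d \<le> t \<longrightarrow> 2 * (\<alpha> - 1) * u \<le> (\<beta> - \<alpha>) * d \<longrightarrow>
    (\<beta> - 1) * g \<le> (\<alpha> - 1) * u + \<epsilon> * t \<longrightarrow> (\<beta> - 1) * t = 4 * u + (1 + 3 * \<beta>) * d + (\<beta> - 1) * g \<longrightarrow>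
    \<epsilon> * (2 * t + d) < (\<alpha> - 1) * \<beta> * d"
    using \<alpha> \<beta> by (intro no_start_estimate) auto
  then show ?thesis
  proof eventually_elim
    case (elim \<epsilon>)
    note est = elim(1)
    show ?case
    proof (intro allI impI, rule ccontr)
      fix Q a l
      assume nc: "near_cone \<epsilon> Q" and a: "Q \<le> a" "V a \<le> 0" "S2_at 4 {q0..} P a 1 l" "\<not> P a 2 < P a 3"
      have qa: "q0 \<le> a" "0 < a" using nc a by (auto simp: near_cone_def)
      have touch: "P a 2 = P a 3" using a(4) ordered[OF qa(1)] by simp
      note tb = touch_bounds[OF nc a(1) touch]
      define t where "t = a + d a"
      note grow = first_grows_to_second[OF qa(1) a(3) t_def]
      have d: "0 \<le> d a" "d a \<le> a" using ordered[OF qa(1)] by (auto simp: d_def)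
      \<comment> \<open>The factor \<open>2 * a + d a\<close> is \<open>a + t\<close>: one error
        comes from the meeting time \<open>a\<close>, the other from \<open>t\<close>.\<close>
      have "\<epsilon> * (2 * a + d a) < (\<alpha> - 1) * \<beta> * d a"
        using est[rule_format, of a "d a" "U a" "P a 4 - P a 3"] qa d tb a(2) unfolding V_def by linarith
      moreover have "(\<alpha> - 1) * U t \<le> (\<beta> - 1) * (P t 4 - P t 2) + \<epsilon> * t"
        using near_coneD(1)[OF nc, of t] a(1) d by (simp add: t_def)
      moreover have "U t = U a + \<beta> * d a" using grow by (simp add: U_def d_def algebra_simps)
      then have "(\<alpha> - 1) * U t = (\<alpha> - 1) * U a + (\<alpha> - 1) * \<beta> * d a" by (simp add: algebra_simps)
      moreover have "\<epsilon> * t = \<epsilon> * (2 * a + d a) - \<epsilon> * a" by (simp add: t_def algebra_simps)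
      ultimately show False using tb(1) grow touch by simp
    qed
  qed
qed

text \<open>After the last meeting time \<open>p\<close> with \<open>V \<le> 0\<close>, P_1 has to
  grow, since otherwise \<open>V\<close> would not increase. From the start \<open>a\<close> of this
  growth to the next meeting time \<open>t'\<close>, P_3 and P_4 rest and P_1 reaches the old P_2,
  so \<open>step_estimate\<close> gives \<open>V t' \<le> 0\<close>, against the choice of
  \<open>p\<close>.\<close>

lemma V_invariant:
  "\<forall>\<^sub>F \<epsilon> in at_right 0. \<forall>Q s t. near_cone \<epsilon> Q \<longrightarrow> Q \<le> s \<longrightarrow> P s 2 = P s 3 \<longrightarrow> V s \<le> 0 \<longrightarrow>
     s \<le> t \<longrightarrow> P t 2 = P t 3 \<longrightarrow> V t \<le> 0"
proof -
  have "\<forall>\<^sub>F \<epsilon> in at_right 0. \<forall>t u d u' d' g'. 0 < t \<longrightarrow> 0 \<le> d \<longrightarrow> 2 * (\<alpha> - 1) * u \<le> (\<beta> - \<alpha>) * d \<longrightarrow>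
    u + \<beta> * d \<le> u' + d' \<longrightarrow> (\<beta> - 1) * g' \<le> \<alpha> * (\<alpha> - 1) * u + \<epsilon> * t \<longrightarrow>
    \<bar>(\<beta> - 1) * g' - (\<alpha> - 1) * u'\<bar> \<le> \<epsilon> * t \<longrightarrow>
    (\<beta> - 1) * t = 4 * u' + (1 + 3 * \<beta>) * d' + (\<beta> - 1) * g' \<longrightarrow> 2 * (\<alpha> - 1) * u' \<le> (\<beta> - \<alpha>) * d'"
    using \<alpha> \<beta> by (intro step_estimate) auto
  from this no_growth_at_touch show ?thesis
  proof eventually_elim
    case (elim \<epsilon>)
    note est = elim(1)
    note ng = elim(2)
    show ?case
    proof (intro allI impI, rule ccontr)
      fix Q s t
      assume nc: "near_cone \<epsilon> Q" and s: "Q \<le> s" "P s 2 = P s 3" "V s \<le> 0"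
        and t: "s \<le> t" "P t 2 = P t 3" and "\<not> V t \<le> 0"
      have qs: "q0 \<le> s" "0 < s" "0 < \<epsilon>" using nc s by (auto simp: near_cone_def)
      obtain p where p: "s \<le> p" "p \<le> t" "P p 2 = P p 3" "V p \<le> 0"
        and last: "\<And>q. p < q \<Longrightarrow> q \<le> t \<Longrightarrow> P q 2 = P q 3 \<Longrightarrow> 0 < V q"
        using last_touch_V[OF qs(1) t(1) s(2,3)] by blast
      have qp: "q0 \<le> p" using p qs by simp
      have "P p 1 < P t 1"
        using V_le(2)[OF qp p(2)] mono[of p t 1] qp p \<open>\<not> V t \<le> 0\<close> by fastforce
      then obtain a l where a: "p \<le> a" "a < t" "P a 1 = P p 1" "S2_at 4 {q0..} P a 1 l"
        using growth_start[OF qp p(2)] by blast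
      have qa: "q0 \<le> a" "Q \<le> a" using qp a p s by auto
      have Va: "V a \<le> 0" using V_le(2)[OF qp a(1,3)] p by simp
      have gap: "P a 2 < P a 3" using ng nc qa(2) Va a(4) by blast
      obtain t' where t': "a \<le> t'" "t' \<le> t" "P t' 2 = P t' 3"
        and gap': "\<And>q. a \<le> q \<Longrightarrow> q < t' \<Longrightarrow> P q 2 < P q 3"
        using first_touch[OF qa(1) less_imp_le[OF a(2)] t(2)] by blast
      \<comment> \<open>Strictness of the gap at \<open>a\<close> puts \<open>t'\<close> after
        \<open>p\<close>, so the choice of \<open>p\<close> applies to it.\<close>
      have "a \<noteq> t'" using gap t' by auto
      then have Vt': "0 < V t'" using last[of t'] a t' by simp
      have Qt': "Q \<le> t'" "0 < t'" using qa t' qs a p by auto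
      note tb = touch_bounds[OF nc Qt'(1) t'(3)]
      have "(\<beta> - 1) * (P t' 4 - P t' 3) \<le> \<alpha> * (\<alpha> - 1) * U a + \<epsilon> * a"
        using upper_const[OF qa(1) a(4) t'(1) gap'] near_coneD(3)[OF nc qa(2)] by simp
      also have "\<dots> \<le> \<alpha> * (\<alpha> - 1) * U a + \<epsilon> * t'" using qs t'(1) by simp
      finally have g: "(\<beta> - 1) * (P t' 4 - P t' 3) \<le> \<alpha> * (\<alpha> - 1) * U a + \<epsilon> * t'" .
      \<comment> \<open>The old P_2 and the new P_1, multiplied by \<open>\<beta> - 1\<close>, are
        the two sides \<open>u + \<beta> * d\<close> and \<open>u' + d'\<close> in the
        estimate.\<close>
      have "(\<beta> - 1) * P a 2 \<le> (\<beta> - 1) * P t' 1"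
        using first_catches_second[OF qa(1) a(4) gap t'(1,3)] \<alpha> \<beta> by simp
      then have "U a + \<beta> * d a \<le> U t' + d t'" unfolding U_def d_def by (simp add: algebra_simps)
      moreover have "0 \<le> d a" using ordered[OF qa(1)] by (simp add: d_def)
      ultimately have "V t' \<le> 0"
        using est[rule_format, OF Qt'(2), of "d a" "U a" "U t'" "d t'" "P t' 4 - P t' 3"] g tb Va
        unfolding V_def by linarith
      then show False using Vt' by simp
    qed
  qed
qed

text \<open>When P_4 - P_2 is small, T_1 makes \<open>U\<close> at most of order
  \<open>\<epsilon> * q\<close>. This persists up to the next meeting time: either P_1 rests and
  \<open>U\<close> does not increase, or T_3 bounds P_4 - P_3 when P_1 starts to grow, this gap is
  kept, and it controls \<open>U\<close> at the meeting time.\<close>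

lemma V_start:
  "\<forall>\<^sub>F \<epsilon> in at_right 0. \<forall>Q q. near_cone \<epsilon> Q \<longrightarrow> Q \<le> q \<longrightarrow> P q 4 - P q 2 \<le> \<epsilon> * q \<longrightarrow>
     (\<exists>t\<ge>q. P t 2 = P t 3 \<and> V t \<le> 0)"
proof -
  have "\<forall>\<^sub>F \<epsilon> in at_right 0. \<forall>t u d g. 0 < t \<longrightarrow> 0 \<le> d \<longrightarrow> (\<alpha> - 1) * u \<le> (\<alpha> * \<beta> + 2) * \<epsilon> * t \<longrightarrow>
    (\<beta> - 1) * g \<le> (\<alpha> - 1) * u + \<epsilon> * t \<longrightarrow> (\<beta> - 1) * t = 4 * u + (1 + 3 * \<beta>) * d + (\<beta> - 1) * g \<longrightarrow>
    2 * (\<alpha> - 1) * u \<le> (\<beta> - \<alpha>) * d"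
    using \<alpha> \<beta> by (intro start_estimate) auto
  then show ?thesis
  proof eventually_elim
    case (elim \<epsilon>)
    note est = elim(1)
    show ?case
    proof (intro allI impI)
      fix Q q
      assume nc: "near_cone \<epsilon> Q" and q: "Q \<le> q" "P q 4 - P q 2 \<le> \<epsilon> * q"
      have qq: "q0 \<le> q" "0 < q" "0 < \<epsilon>" using nc q by (auto simp: near_cone_def)
      obtain t0 where "q \<le> t0" "P t0 2 = P t0 3" using touch_exists[OF qq(1)] .
      then obtain t where t: "q \<le> t" "P t 2 = P t 3"
        and gap: "\<And>r. q \<le> r \<Longrightarrow> r < t \<Longrightarrow> P r 2 < P r 3"
        using first_touch[OF qq(1)] by metis
      have qt: "q0 \<le> t" "Q \<le> t" "0 < t" using qq q t by auto
      note tb = touch_bounds[OF nc qt(2) t(2)]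
      have "(\<beta> - 1) * (P q 4 - P q 2) \<le> (\<beta> - 1) * (\<epsilon> * q)" using q \<alpha> \<beta> by simp
      then have Uq: "(\<alpha> - 1) * U q \<le> \<beta> * \<epsilon> * q" using near_coneD(1)[OF nc q(1)] by (simp add: algebra_simps)
      \<comment> \<open>T_3 turns the bound \<open>\<beta> * \<epsilon> * q\<close> into
        \<open>\<alpha> * \<beta> * \<epsilon> * t\<close> plus one error
        \<open>\<epsilon> * t\<close>, and \<open>touch_bounds\<close> adds a second one.\<close>
      have Ut: "(\<alpha> - 1) * U t \<le> (\<alpha> * \<beta> + 2) * \<epsilon> * t"
      proof (cases "P t 1 = P q 1")
        case True
        have "(\<alpha> - 1) * U t \<le> (\<alpha> - 1) * U q"
          using V_le(1)[OF qq(1) t(1) True] \<alpha> by (intro mult_left_mono) auto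
        also have "\<dots> \<le> \<beta> * \<epsilon> * q" by (rule Uq)
        also have "\<dots> \<le> (\<alpha> * \<beta> + 2) * \<epsilon> * t"
          using qq t \<alpha> \<beta> by (intro mult_mono) (auto simp: add_increasing2)
        finally show ?thesis .
      next
        case False
        then have "P q 1 < P t 1" using mono[of q t 1] qq t by simp
        then obtain a l where a: "q \<le> a" "a < t" "P a 1 = P q 1" "S2_at 4 {q0..} P a 1 l"
          using growth_start[OF qq(1) t(1)] by blast
        have qa: "q0 \<le> a" "Q \<le> a" using qq a q by auto
        have "P t 3 = P a 3" "P t 4 = P a 4"
          using upper_const[OF qa(1) a(4) less_imp_le[OF a(2)]] gap a(1) by force+
        then have "(\<beta> - 1) * (P t 4 - P t 3) \<le> \<alpha> * ((\<alpha> - 1) * U a) + \<epsilon> * a"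
          using near_coneD(3)[OF nc qa(2)] by simp
        also have "\<dots> \<le> \<alpha> * ((\<alpha> - 1) * U q) + \<epsilon> * t"
          using V_le(1)[OF qq(1) a(1,3)] \<alpha> qq a(2) by (intro add_mono mult_left_mono) auto
        also have "\<dots> \<le> \<alpha> * (\<beta> * \<epsilon> * t) + \<epsilon> * t"
        proof -
          have "\<beta> * \<epsilon> * q \<le> \<beta> * \<epsilon> * t" using t qq \<alpha> \<beta> by (intro mult_left_mono) auto
          then show ?thesis using Uq \<alpha> qq by (intro add_mono mult_left_mono) auto
        qed
        finally show ?thesis using tb(1) by (simp add: algebra_simps)
      qed
      have "0 \<le> d t" using ordered[OF qt(1)] by (simp add: d_def)
      then have "2 * (\<alpha> - 1) * U t \<le> (\<beta> - \<alpha>) * d t"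
        using est[rule_format, OF qt(3) _ Ut _ tb(2)] tb(1) by linarith
      then show "\<exists>t\<ge>q. P t 2 = P t 3 \<and> V t \<le> 0" using t unfolding V_def by auto
    qed
  qed
qed

text \<open>The gap P_4 - P_3 at \<open>q\<close> is traced back to a time \<open>a \<le> q\<close>
  with \<open>V a \<le> 0\<close>: to \<open>q\<close> itself if P_1 has rested since the last
  meeting time, and otherwise to the start of growth of P_1, after which P_3 and P_4 are fixed.
  There \<open>extremal_estimate\<close> applies.\<close>

lemma no_extremal:
  assumes c: "c = \<alpha> * (\<alpha> - 1) / (2 + \<alpha> + \<alpha>\<^sup>2)"
  shows "\<forall>\<^sub>F \<epsilon> in at_right 0. \<forall>Q s q. near_cone \<epsilon> Q \<longrightarrow> Q \<le> s \<longrightarrow> P s 2 = P s 3 \<longrightarrow> V s \<le> 0 \<longrightarrow>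
     s \<le> q \<longrightarrow> P q 4 - P q 3 < (c - \<epsilon>) * q"
proof -
  have "0 < c" unfolding c using \<alpha> by (intro divide_pos_pos) (auto intro: add_pos_pos)
  then have "\<forall>\<^sub>F \<epsilon> in at_right 0. 1 * \<epsilon> < c" by (rule eventually_mult_less)
  moreover have "\<forall>\<^sub>F \<epsilon> in at_right 0. \<forall>t x u d g. 0 < t \<longrightarrow> 0 \<le> d \<longrightarrow> 2 * (\<alpha> - 1) * u \<le> (\<beta> - \<alpha>) * d \<longrightarrow>
    (\<beta> - 1) * g \<le> \<alpha> * (\<alpha> - 1) * u + \<epsilon> * t \<longrightarrow>
    (\<beta> - 1) * g + (\<alpha> - 1) * \<beta> * d \<le> (\<alpha> - 1) * (\<beta> - 1) * x + \<epsilon> * t \<longrightarrow>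
    (\<beta> - 1) * t = 2 * u + (1 + \<beta>) * d + 2 * (\<beta> - 1) * x + (\<beta> - 1) * g \<longrightarrow> g < (c - \<epsilon>) * t"
    using \<alpha> \<beta> c by (intro extremal_estimate) auto
  ultimately show ?thesis using no_growth_at_touch V_invariant
  proof eventually_elim
    case (elim \<epsilon>)
    note est = elim(2)
    note ng = elim(3)
    note inv = elim(4)
    show ?case
    proof (intro allI impI, rule ccontr)
      fix Q s q
      assume nc: "near_cone \<epsilon> Q" and s: "Q \<le> s" "P s 2 = P s 3" "V s \<le> 0" "s \<le> q"
        and big: "\<not> P q 4 - P q 3 < (c - \<epsilon>) * q"
      have qs: "q0 \<le> s" "0 < s" using nc s by (auto simp: near_cone_def)
      define X where "X = {r \<in> {s..q}. P r 2 = P r 3}"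
      have "compact X" "s \<in> X" using compact_touch[OF qs(1), of q] s by (auto simp: X_def)
      then obtain p where p: "p \<in> X" "\<forall>r\<in>X. r \<le> p" using compact_attains_sup[of X] by blast
      have gap: "P r 2 < P r 3" if "p < r" "r \<le> q" for r
      proof -
        have "r \<notin> X" using p(2) that by force
        then show ?thesis using that p(1) ordered(3)[of r] qs by (auto simp: X_def)
      qed
      have p': "s \<le> p" "p \<le> q" "P p 2 = P p 3" using p(1) by (auto simp: X_def)
      have qp: "q0 \<le> p" using p' qs by simp
      have Vp: "V p \<le> 0" using inv nc s p' by blast
      have "\<exists>a. p \<le> a \<and> a \<le> q \<and> V a \<le> 0 \<and> P a 4 - P a 3 = P q 4 - P q 3"
      proof (cases "P q 1 = P p 1")
        case True
        then show ?thesis using V_le(2)[OF qp p'(2)] Vp p'(2) by (intro exI[of _ q]) auto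
      next
        case False
        then have "P p 1 < P q 1" using mono[of p q 1] qp p' by simp
        then obtain a l where a: "p \<le> a" "a < q" "P a 1 = P p 1" "S2_at 4 {q0..} P a 1 l"
          using growth_start[OF qp p'(2)] by blast
        have Va: "V a \<le> 0" using V_le(2)[OF qp a(1,3)] Vp by simp
        have "Q \<le> a" using a p' s by simp
        then have "P a 2 < P a 3" using ng nc Va a(4) by blast
        then have "P r 2 < P r 3" if "a \<le> r" "r < q" for r
          using gap[of r] that a(1) by (cases "r = a") auto
        then have "P q 3 = P a 3" "P q 4 = P a 4"
          using upper_const[OF _ a(4) less_imp_le[OF a(2)]] qp a(1) by auto
        then show ?thesis using a Va by (intro exI[of _ a]) auto
      qed
      then obtain a where a: "p \<le> a" "a \<le> q" "V a \<le> 0" "P a 4 - P a 3 = P q 4 - P q 3" by blast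
      have qa: "q0 \<le> a" "Q \<le> a" "0 < a" using a p' s qs by auto
      have "0 \<le> d a" using ordered[OF qa(1)] by (simp add: d_def)
      then have "P a 4 - P a 3 < (c - \<epsilon>) * a"
        using est[rule_format, OF qa(3), of "d a" "U a" "P a 4 - P a 3" "P a 3"]
          near_coneD(2,3)[OF nc qa(2)] size_split[OF qa(1)] a(3) unfolding V_def by simp
      \<comment> \<open>\<open>\<epsilon> < c\<close> makes the factor positive, so passing to the
        later time \<open>q\<close> weakens the bound.\<close>
      also have "\<dots> \<le> (c - \<epsilon>) * q" using elim(1) a(2) by (intro mult_left_mono) auto
      finally show False using big a(4) by simp
    qed
  qed
qed

end

section \<open>The quantities attached to \<open>\<mu>\<close>\<close>

lemma mu_nonneg:
  assumes "\<And>q. q1 \<le> q \<Longrightarrow> 0 \<le> T (P q) i"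
  shows "0 \<le> mu T P i"
  unfolding mu_def
proof (rule Liminf_bounded)
  show "\<forall>\<^sub>F q in at_top. 0 \<le> ereal (inverse q * T (P q) i)"
    using eventually_ge_at_top[of "max q1 1"] by eventually_elim (use assms in auto)
qed

lemma mu_le:
  assumes "\<And>Q. \<exists>q\<ge>Q. 0 < q \<and> T (P q) i \<le> y * q"
  shows "mu T P i \<le> ereal y"
proof (rule ccontr)
  assume "\<not> ?thesis"
  then have "ereal y < mu T P i" by simp
  then have "\<forall>\<^sub>F q in at_top. ereal y < ereal (inverse q * T (P q) i)"
    unfolding mu_def by (rule less_LiminfD)
  then obtain Q where Q: "\<And>q. Q \<le> q \<Longrightarrow> ereal y < ereal (inverse q * T (P q) i)"
    unfolding eventually_at_top_linorder by blast
  obtain q where "Q \<le> q" "0 < q" "T (P q) i \<le> y * q" using assms by blast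
  then show False using Q[of q] by (simp add: field_simps)
qed

lemma eventually_of_mu_nonneg:
  assumes "0 \<le> mu T P i" "0 < \<epsilon>"
  shows "\<forall>\<^sub>F q in at_top. - \<epsilon> * q \<le> T (P q) i"
proof -
  have "ereal (- \<epsilon>) < 0" using assms(2) by simp
  then have "\<forall>\<^sub>F q in at_top. ereal (- \<epsilon>) < ereal (inverse q * T (P q) i)"
    using assms(1) unfolding mu_def le_Liminf_iff by blast
  then show ?thesis using eventually_gt_at_top[of 0]
    by eventually_elim (simp add: field_simps)
qed

lemma frequently_of_mu_le:
  assumes "mu T P i \<le> ereal y" "0 < \<epsilon>"
  obtains q where "Q \<le> q" "T (P q) i \<le> (y + \<epsilon>) * q"
proof -
  have "\<exists>q\<ge>Q. T (P q) i \<le> (y + \<epsilon>) * q"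
  proof (rule ccontr)
    assume "\<not> ?thesis"
    then have less: "(y + \<epsilon>) * q < T (P q) i" if "Q \<le> q" for q using that by force
    have "\<forall>\<^sub>F q in at_top. ereal (y + \<epsilon>) \<le> ereal (inverse q * T (P q) i)"
      using eventually_ge_at_top[of Q] eventually_gt_at_top[of 0]
    proof eventually_elim
      case (elim q)
      then show ?case using less[of q] by (simp add: field_simps)
    qed
    then have "ereal (y + \<epsilon>) \<le> mu T P i" unfolding mu_def by (rule Liminf_bounded)
    then have "ereal (y + \<epsilon>) \<le> ereal y" using assms(1) by (rule order_trans)
    then show False using assms(2) by simp
  qed
  then show thesis using that by blast
qed

section \<open>Self-similar generalized systems\<close>

text \<open>At an interior point the slopes on both sides equal the derivative, so the slope
  \<open>c\<close> found at \<open>a\<close> is passed on to the right.\<close>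

lemma piecewise_linear_affine:
  assumes pl: "piecewise_linear_on I f" and sub: "{a..b} \<subseteq> I" and ab: "a \<le> b"
    and diff: "\<And>q. a < q \<Longrightarrow> q < b \<Longrightarrow> f differentiable (at q)"
  obtains c where "\<And>t. a \<le> t \<Longrightarrow> t \<le> b \<Longrightarrow> f t = f a + (t - a) * c"
proof -
  have "a \<in> I" using sub ab by auto
  then obtain e0 c where e0: "e0 > 0"
    and c: "\<forall>t \<in> I \<inter> {a..a + e0}. f t = f a + (t - a) * c"
    using pl unfolding piecewise_linear_on_def by blast
  have affine: "f t = f a + (t - a) * c" if t: "a \<le> t" "t \<le> b" for t
  proof (rule interval_induct[where Q = "\<lambda>t. f t = f a + (t - a) * c" and a = a and b = b])
    fix q assume q: "a \<le> q" "q < b" and IH: "\<And>r. a \<le> r \<Longrightarrow> r \<le> q \<Longrightarrow> f r = f a + (r - a) * c"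
    show "\<exists>e>0. \<forall>r. q < r \<and> r \<le> q + e \<and> r \<le> b \<longrightarrow> f r = f a + (r - a) * c"
    proof (cases "q = a")
      case True
      show ?thesis
      proof (intro exI[of _ e0] conjI allI impI e0)
        fix r assume "q < r \<and> r \<le> q + e0 \<and> r \<le> b"
        then have "r \<in> I \<inter> {a..a + e0}" using sub True by auto
        then show "f r = f a + (r - a) * c" using c by blast
      qed
    next
      case False
      then have aq: "a < q" using q by simp
      have "q \<in> I" using sub q by auto
      then obtain e s where e: "e > 0" and s: "\<forall>t \<in> I \<inter> {q..q + e}. f t = f q + (t - q) * s"
        using pl unfolding piecewise_linear_on_def by blast
      obtain D where "DERIV f q :> D"
        using diff[OF aq q(2)] real_differentiable_def by blast
      then have lim: "((\<lambda>t. (f t - f q) / (t - q)) \<longlongrightarrow> D) (at q)"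
        by (simp add: has_field_derivative_iff)
      have "\<forall>\<^sub>F t in at_right q. (f t - f q) / (t - q) = s"
      proof -
        have "\<forall>\<^sub>F t in at_right q. t < min b (q + e)"
          using q e by (intro eventually_at_rightI[of q "min b (q + e)"]) auto
        then show ?thesis using eventually_at_right_less[of q]
        proof eventually_elim
          case (elim t)
          then have "t \<in> I" using sub aq by auto
          then show ?case using s[THEN bspec, of t] elim by simp
        qed
      qed
      then have "((\<lambda>t. (f t - f q) / (t - q)) \<longlongrightarrow> s) (at_right q)" by (rule tendsto_eventually)
      moreover have "((\<lambda>t. (f t - f q) / (t - q)) \<longlongrightarrow> D) (at_right q)"
        using lim by (rule filterlim_mono) (auto intro: at_le)
      ultimately have "s = D" using tendsto_unique trivial_limit_at_right_real by blast
      have "\<forall>\<^sub>F t in at_left q. (f t - f q) / (t - q) = c"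
      proof -
        have "\<forall>\<^sub>F t in at_left q. a < t \<and> t < q"
          using aq by (intro eventually_at_leftI[of a q]) auto
        then show ?thesis
        proof eventually_elim
          case (elim t)
          then have "f t - f q = (t - q) * c" using IH[of t] IH[of q] q by (simp add: algebra_simps)
          then show ?case using elim by simp
        qed
      qed
      then have "((\<lambda>t. (f t - f q) / (t - q)) \<longlongrightarrow> c) (at_left q)" by (rule tendsto_eventually)
      moreover have "((\<lambda>t. (f t - f q) / (t - q)) \<longlongrightarrow> D) (at_left q)"
        using lim by (rule filterlim_mono) (auto intro: at_le)
      ultimately have "c = D" using tendsto_unique trivial_limit_at_left_real by blast
      show ?thesis
      proof (intro exI[of _ e] conjI allI impI e)
        fix r assume r: "q < r \<and> r \<le> q + e \<and> r \<le> b"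
        then have "r \<in> I" using sub aq by auto
        then have "f r = f q + (r - q) * c" using s[THEN bspec, of r] r \<open>s = D\<close> \<open>c = D\<close> by simp
        then show "f r = f a + (r - a) * c" using IH[of q] q by (simp add: algebra_simps)
      qed
    qed
  next
    fix q assume q: "a < q" "q \<le> b" and IH: "\<And>r. a \<le> r \<Longrightarrow> r < q \<Longrightarrow> f r = f a + (r - a) * c"
    have "q \<in> I" using sub q by auto
    then obtain e s where e: "e > 0" and s: "\<forall>t \<in> I \<inter> {q - e..q}. f t = f q + (t - q) * s"
      using pl unfolding piecewise_linear_on_def by blast
    define r where "r = max a (q - e)"
    have r: "a \<le> r" "r < q" "q - e \<le> r" using q e by (auto simp: r_def)
    \<comment> \<open>Two points before \<open>q\<close> determine the slope of the affine piece
      that ends at \<open>q\<close>.\<close>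
    define r' where "r' = (r + q) / 2"
    have r': "a \<le> r'" "r' < q" "q - e \<le> r'" "r < r'" using r by (auto simp: r'_def)
    have "r \<in> I" "r' \<in> I" using sub r r' q by auto
    then have *: "f r = f q + (r - q) * s" "f r' = f q + (r' - q) * s"
      using s[THEN bspec, of r] s[THEN bspec, of r'] r r' by simp_all
    have IH': "f r = f a + (r - a) * c" "f r' = f a + (r' - a) * c" using IH[of r] IH[of r'] r r' by auto
    have "(r' - r) * s = (r' - r) * c" using * IH' by (simp add: algebra_simps)
    then have "s = c" using r' by simp
    then show "f q = f a + (q - a) * c" using *(1) IH'(1) by (simp add: algebra_simps)
  qed (use ab t in auto)
  then show thesis using that by blast
qed

lemma T_map_cong:
  assumes "\<And>j. j \<in> {1..4} \<Longrightarrow> x j = y j"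
  shows "T_map \<alpha> \<beta> x = T_map \<alpha> \<beta> y"
  using assms[of 1] assms[of 2] assms[of 3] assms[of 4] by (simp add: T_map_def)

lemma T_map_linear:
  assumes "\<And>j. j \<in> {1..4} \<Longrightarrow> x j = a * y j + b * z j" and i: "i \<in> {1..5}"
  shows "T_map \<alpha> \<beta> x i = a * T_map \<alpha> \<beta> y i + b * T_map \<alpha> \<beta> z i"
proof -
  have x: "x 1 = a * y 1 + b * z 1" "x 2 = a * y 2 + b * z 2" "x 3 = a * y 3 + b * z 3"
    "x 4 = a * y 4 + b * z 4" using assms by auto
  have "i = 1 \<or> i = 2 \<or> i = 3 \<or> i = 4 \<or> i = 5" using i by auto
  then show ?thesis
    by (elim disjE; simp only: T_map_simps x; simp add: algebra_simps)
qed

text \<open>Between neighbouring parameters of division points the system is affine, so by linearity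
  the value of T is a convex combination of its values at two division points.\<close>

lemma generalized_system_nonneg:
  assumes sys: "generalized_n_system 4 {a..b} P" and ab: "a \<le> b"
    and fin: "finite (division_points 4 {a..b} P)" and i: "i \<in> {1..5}"
    and nonneg: "\<And>x. x \<in> division_points 4 {a..b} P \<Longrightarrow> 0 \<le> T_map \<alpha> \<beta> x i"
    and q: "a \<le> q" "q \<le> b"
  shows "0 \<le> T_map \<alpha> \<beta> (P q) i"
proof -
  define N where "N = frontier {a..b} \<union>
    {q \<in> interior {a..b}. \<not> (\<forall>j\<in>{1..4}. (\<lambda>t. P t j) differentiable (at q))}"
  have dp: "division_points 4 {a..b} P = (\<lambda>q. restrict (P q) {1..4}) ` N"
    by (simp add: division_points_def N_def)
  have front: "a \<in> N" "b \<in> N" using ab by (auto simp: N_def frontier_def)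
  have N_sub: "N \<subseteq> {a..b}" by (auto simp: N_def frontier_def)
  have sum: "(\<Sum>j = 1..4. restrict (P q) {1..4} j) = q" if "q \<in> N" for q
    using sys N_sub that by (auto simp: generalized_n_system_def S1_at_def)
  \<comment> \<open>By (S1) a division point determines its parameter as the sum of its coordinates,
    so finitely many points come from finitely many parameters.\<close>
  have "inj_on (\<lambda>q. restrict (P q) {1..4}) N"
    by (rule inj_onI) (metis sum)
  then have finN: "finite N" using fin unfolding dp by (rule finite_imageD[rotated])
  have N_nonneg: "0 \<le> T_map \<alpha> \<beta> (P r) i" if "r \<in> N" for r
  proof -
    have "T_map \<alpha> \<beta> (P r) = T_map \<alpha> \<beta> (restrict (P r) {1..4})" by (rule T_map_cong) simp
    then show ?thesis using nonneg[of "restrict (P r) {1..4}"] that dp by auto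
  qed
  show ?thesis
  proof (cases "q \<in> N")
    case True
    then show ?thesis by (rule N_nonneg)
  next
    case False
    define s where "s = Max {r \<in> N. r \<le> q}"
    define t where "t = Min {r \<in> N. q \<le> r}"
    have "s \<in> {r \<in> N. r \<le> q}" unfolding s_def using finN front q by (intro Max_in) auto
    then have s: "s \<in> N" "s < q" using False by (auto simp: less_le)
    have "t \<in> {r \<in> N. q \<le> r}" unfolding t_def using finN front q by (intro Min_in) auto
    then have t: "t \<in> N" "q < t" using False by (auto simp: less_le)
    have between: "r \<notin> N" if "s < r" "r < t" for r
    proof
      assume "r \<in> N"
      then have "r \<le> s" if "r \<le> q" using finN that unfolding s_def by (intro Max_ge) auto
      moreover have "t \<le> r" if "q \<le> r"
        using finN that \<open>r \<in> N\<close> unfolding t_def by (intro Min_le) auto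
      ultimately show False using that by linarith
    qed
    have st: "{s..t} \<subseteq> {a..b}" using s t N_sub by auto
    define \<theta> where "\<theta> = (q - s) / (t - s)"
    have \<theta>: "0 \<le> \<theta>" "\<theta> \<le> 1" using s t by (auto simp: \<theta>_def)
    have "P q j = (1 - \<theta>) * P s j + \<theta> * P t j" if j: "j \<in> {1..4}" for j
    proof -
      have pl: "piecewise_linear_on {a..b} (\<lambda>q. P q j)"
        using sys j by (auto simp: generalized_n_system_def)
      have diff: "(\<lambda>q. P q j) differentiable (at r)" if r: "s < r" "r < t" for r
      proof -
        have "r \<in> interior {a..b}" using r st by (auto simp:)
        then show ?thesis using between[OF r] j by (auto simp: N_def)
      qed
      obtain c where c: "\<And>r. s \<le> r \<Longrightarrow> r \<le> t \<Longrightarrow> P r j = P s j + (r - s) * c"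
        using piecewise_linear_affine[OF pl st _ diff] s t by (metis less_trans less_imp_le)
      have Pt: "P t j = P s j + (t - s) * c" using c[of t] s t by simp
      have "\<theta> * (t - s) = q - s" using s t by (simp add: \<theta>_def)
      moreover have "(1 - \<theta>) * P s j + \<theta> * P t j = P s j + \<theta> * (t - s) * c"
        unfolding Pt by (simp add: algebra_simps)
      ultimately show ?thesis using c[of q] s t by simp
    qed
    then have "T_map \<alpha> \<beta> (P q) i = (1 - \<theta>) * T_map \<alpha> \<beta> (P s) i + \<theta> * T_map \<alpha> \<beta> (P t) i"
      using i by (rule T_map_linear)
    then show ?thesis using N_nonneg[OF s(1)] N_nonneg[OF t(1)] \<theta> by simp
  qed
qed

lemma division_point_value:
  assumes sys: "generalized_n_system 4 {a..b} P"
    and x: "x \<in> division_points 4 {a..b} P" and q: "q = (\<Sum>j = 1..4. x j)"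
  shows "a \<le> q" "T_map \<alpha> \<beta> (P q) = T_map \<alpha> \<beta> x"
proof -
  obtain r where "r \<in> frontier {a..b} \<union> interior {a..b}" and x_eq: "x = restrict (P r) {1..4}"
    using x unfolding division_points_def by blast
  then have r: "r \<in> {a..b}" "x = restrict (P r) {1..4}"
    by (auto simp: frontier_def)
  have "(\<Sum>j = 1..4. P r j) = r" using sys r by (auto simp: generalized_n_system_def S1_at_def)
  then have "q = r" using r q by simp
  then show "a \<le> q" using r by simp
  show "T_map \<alpha> \<beta> (P q) = T_map \<alpha> \<beta> x"
    unfolding \<open>q = r\<close> r(2) by (rule T_map_cong) simp
qed

section \<open>Lower limits of T along a self-similar system\<close>

locale self_similar =
  fixes \<gamma> a :: real and P :: "real \<Rightarrow> nat \<Rightarrow> real"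
  assumes \<gamma>: "1 < \<gamma>" and a: "0 < a"
    and system: "generalized_n_system 4 {a..\<gamma> * a} P"
    and finite_dp: "finite (division_points 4 {a..\<gamma> * a} P)"
    and scale: "\<forall>q\<ge>a. \<forall>j\<in>{1..4}. P (\<gamma> * q) j = \<gamma> * P q j"
begin

lemma T_map_scale:
  assumes "a \<le> q" "i \<in> {1..5}"
  shows "T_map \<alpha> \<beta> (P (\<gamma> * q)) i = \<gamma> * T_map \<alpha> \<beta> (P q) i"
proof -
  have "T_map \<alpha> \<beta> (P (\<gamma> * q)) i = \<gamma> * T_map \<alpha> \<beta> (P q) i + 0 * T_map \<alpha> \<beta> (P q) i"
    using scale assms by (intro T_map_linear) auto
  then show ?thesis by simp
qed

text \<open>Repeated division by \<open>\<gamma>\<close> brings every \<open>q\<close> into the base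
  interval and changes T only by a positive factor.\<close>

lemma T_map_nonneg:
  assumes i: "i \<in> {1..5}"
    and nonneg: "\<And>x. x \<in> division_points 4 {a..\<gamma> * a} P \<Longrightarrow> 0 \<le> T_map \<alpha> \<beta> x i"
    and q: "a \<le> q"
  shows "0 \<le> T_map \<alpha> \<beta> (P q) i"
proof -
  have step: "a \<le> q \<Longrightarrow> q \<le> \<gamma> ^ k * a \<Longrightarrow> 0 \<le> T_map \<alpha> \<beta> (P q) i" for k q
  proof (induction k arbitrary: q)
    case 0
    then show ?case
      using generalized_system_nonneg[OF system _ finite_dp i nonneg, of q] \<gamma> a by simp
  next
    case (Suc k)
    show ?case
    proof (cases "q \<le> \<gamma> * a")
      case True
      then show ?thesis
        using generalized_system_nonneg[OF system _ finite_dp i nonneg, of q] Suc.prems \<gamma> a by simp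
    next
      case False
      then have "a \<le> q / \<gamma>" "q / \<gamma> \<le> \<gamma> ^ k * a" using Suc.prems \<gamma> by (auto simp: field_simps)
      then show ?thesis using T_map_scale[OF _ i, of "q / \<gamma>" \<alpha> \<beta>] Suc.IH[of "q / \<gamma>"] \<gamma> by simp
    qed
  qed
  obtain k where "q / a < \<gamma> ^ k" using real_arch_pow[OF \<gamma>] by blast
  then show ?thesis using step[of q k] q a by (simp add: field_simps)
qed

text \<open>The copies of a division point under powers of \<open>\<gamma>\<close> occur at
  arbitrarily large times with the same ratio of T_i to the time, so this ratio bounds the lower
  limit from above.\<close>

lemma mu_le_division_point:
  assumes i: "i \<in> {1..5}" and x: "x \<in> division_points 4 {a..\<gamma> * a} P"
    and le: "T_map \<alpha> \<beta> x i \<le> y * (\<Sum>j = 1..4. x j)"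
  shows "mu (T_map \<alpha> \<beta>) P i \<le> ereal y"
proof (rule mu_le)
  fix Q
  define q where "q = (\<Sum>j = 1..4. x j)"
  note val = division_point_value(1)[OF system x q_def] division_point_value(2)[OF system x q_def, of \<alpha> \<beta>]
  have iter: "a \<le> \<gamma> ^ k * q \<and> T_map \<alpha> \<beta> (P (\<gamma> ^ k * q)) i = \<gamma> ^ k * T_map \<alpha> \<beta> x i" for k
  proof (induction k)
    case 0
    then show ?case using val by simp
  next
    case (Suc k)
    then have "a \<le> \<gamma> * (\<gamma> ^ k * q)" using \<gamma> a by (smt (verit) mult_le_cancel_right1)
    then show ?case using T_map_scale[OF _ i, of "\<gamma> ^ k * q" \<alpha> \<beta>] Suc by (simp add: mult_ac)
  qed
  have "0 < q" using val a by simp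
  obtain k where k: "Q / q < \<gamma> ^ k" using real_arch_pow[OF \<gamma>] by blast
  have "\<gamma> ^ k * T_map \<alpha> \<beta> x i \<le> \<gamma> ^ k * (y * q)"
    using le \<gamma> unfolding q_def by (intro mult_left_mono) auto
  then show "\<exists>q\<ge>Q. 0 < q \<and> T_map \<alpha> \<beta> (P q) i \<le> y * q"
    using k \<open>0 < q\<close> iter[of k] \<gamma> by (intro exI[of _ "\<gamma> ^ k * q"]) (auto simp: field_simps)
qed

end

section \<open>Values of T at the division points of R and S\<close>

lemma T_map_point:
  "T_map \<alpha> \<beta> (point [w, x, y, z]) 1 = (\<beta> - 1) * (z - x) - (\<alpha> - 1) * (\<beta> * w - x)"
  "T_map \<alpha> \<beta> (point [w, x, y, z]) 2 = \<alpha> * (\<beta> - 1) * y - (\<beta> - 1) * z - (\<alpha> - 1) * \<beta> * (x - w)"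
  "T_map \<alpha> \<beta> (point [w, x, y, z]) 3 = \<alpha> * (\<alpha> - 1) * (\<beta> * w - x) - (\<beta> - 1) * (z - y)"
  "T_map \<alpha> \<beta> (point [w, x, y, z]) 4 = y - z"
  "T_map \<alpha> \<beta> (point [w, x, y, z]) 5 = z - x"
  "(\<Sum>j = 1..4. point [w, x, y, z] j) = w + x + y + z"
proof -
  have "{1..4} = {1, 2, 3, 4 :: nat}" by auto
  then show "(\<Sum>j = 1..4. point [w, x, y, z] j) = w + x + y + z" by (simp add: point_def)
qed (simp_all only: T_map_simps, simp_all add: point_def)

text \<open>All four division points lie in the cone where T_1, T_2, T_3 are nonnegative. The bound
  for T_4 is its ratio to the coordinate sum at the third of them.\<close>

lemma mu_R:
  assumes R: "is_R \<alpha> R" and \<alpha>: "1 < \<alpha>" "\<alpha> < \<beta>"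
  shows "i \<in> {1, 2, 3} \<Longrightarrow> 0 \<le> mu (T_map \<alpha> \<beta>) R i"
    "mu (T_map \<alpha> \<beta>) R 4 \<le> ereal (- (\<alpha> * (\<alpha> - 1) / (2 + \<alpha> + \<alpha>\<^sup>2)))"
proof -
  have dp: "division_points 4 {3 + \<alpha>..\<alpha> * (3 + \<alpha>)} R =
      {point [1, 1, 1, \<alpha>], point [1, 1, \<alpha>, \<alpha>], point [1, 1, \<alpha>, \<alpha>\<^sup>2], point [\<alpha>, \<alpha>, \<alpha>, \<alpha>\<^sup>2]}"
    using R by (simp add: is_R_def)
  interpret self_similar \<alpha> "3 + \<alpha>" R
    using R \<alpha> dp by unfold_locales (simp_all add: is_R_def)
  \<comment> \<open>The common factor of all nonzero values below, which makes their signs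
    visible.\<close>
  define K where "K = (\<alpha> - 1) * (\<beta> - 1)"
  have "0 \<le> K" using \<alpha> by (simp add: K_def)
  then have pos: "0 \<le> \<alpha> * K" "0 \<le> (\<alpha> - 1) * K" "0 \<le> \<alpha> * ((\<alpha> - 1) * K)" using \<alpha> by simp_all
  have vals: "T_map \<alpha> \<beta> (point [1, 1, 1, \<alpha>]) 1 = 0"
    "T_map \<alpha> \<beta> (point [1, 1, 1, \<alpha>]) 2 = 0"
    "T_map \<alpha> \<beta> (point [1, 1, 1, \<alpha>]) 3 = (\<alpha> - 1) * K"
    "T_map \<alpha> \<beta> (point [1, 1, \<alpha>, \<alpha>]) 1 = 0"
    "T_map \<alpha> \<beta> (point [1, 1, \<alpha>, \<alpha>]) 2 = \<alpha> * K"
    "T_map \<alpha> \<beta> (point [1, 1, \<alpha>, \<alpha>]) 3 = \<alpha> * K"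
    "T_map \<alpha> \<beta> (point [1, 1, \<alpha>, \<alpha>\<^sup>2]) 1 = \<alpha> * K"
    "T_map \<alpha> \<beta> (point [1, 1, \<alpha>, \<alpha>\<^sup>2]) 2 = 0"
    "T_map \<alpha> \<beta> (point [1, 1, \<alpha>, \<alpha>\<^sup>2]) 3 = 0"
    "T_map \<alpha> \<beta> (point [\<alpha>, \<alpha>, \<alpha>, \<alpha>\<^sup>2]) 1 = 0"
    "T_map \<alpha> \<beta> (point [\<alpha>, \<alpha>, \<alpha>, \<alpha>\<^sup>2]) 2 = 0"
    "T_map \<alpha> \<beta> (point [\<alpha>, \<alpha>, \<alpha>, \<alpha>\<^sup>2]) 3 = \<alpha> * ((\<alpha> - 1) * K)"
    unfolding T_map_point K_def by algebra+
  have nonneg: "0 \<le> T_map \<alpha> \<beta> x i"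
    if "x \<in> division_points 4 {3 + \<alpha>..\<alpha> * (3 + \<alpha>)} R" "i \<in> {1, 2, 3}" for x i
    using that unfolding dp by (elim insertE emptyE) (simp_all only: vals pos order_refl)
  show "0 \<le> mu (T_map \<alpha> \<beta>) R i" if i: "i \<in> {1, 2, 3}"
  proof (rule mu_nonneg)
    fix q assume "3 + \<alpha> \<le> q"
    then show "0 \<le> T_map \<alpha> \<beta> (R q) i" using i nonneg by (intro T_map_nonneg) auto
  qed
  have "0 < 2 + \<alpha> + \<alpha>\<^sup>2" using \<alpha> by (intro add_pos_pos) auto
  then have "T_map \<alpha> \<beta> (point [1, 1, \<alpha>, \<alpha>\<^sup>2]) 4
      \<le> - (\<alpha> * (\<alpha> - 1) / (2 + \<alpha> + \<alpha>\<^sup>2)) * (\<Sum>j = 1..4. point [1, 1, \<alpha>, \<alpha>\<^sup>2] j)"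
    unfolding T_map_point by (simp add: field_simps power2_eq_square)
  then show "mu (T_map \<alpha> \<beta>) R 4 \<le> ereal (- (\<alpha> * (\<alpha> - 1) / (2 + \<alpha> + \<alpha>\<^sup>2)))"
    by (rule mu_le_division_point[rotated 2]) (simp_all add: dp)
qed

text \<open>The division points lie in the same cone, and T_5 vanishes at the first of them, whose
  last three coordinates agree.\<close>

lemma mu_S:
  assumes S: "is_S \<beta> S" and \<alpha>: "1 < \<alpha>" "\<alpha> < \<beta>"
  shows "i \<in> {1, 2, 3} \<Longrightarrow> 0 \<le> mu (T_map \<alpha> \<beta>) S i" "mu (T_map \<alpha> \<beta>) S 5 \<le> ereal 0"
proof -
  have dp: "division_points 4 {1 + 3 * \<beta>..\<beta> * (1 + 3 * \<beta>)} S =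
      {point [1, \<beta>, \<beta>, \<beta>], point [1, \<beta>, \<beta>\<^sup>2, \<beta>\<^sup>2], point [\<beta>, \<beta>, \<beta>\<^sup>2, \<beta>\<^sup>2], point [\<beta>, \<beta>\<^sup>2, \<beta>\<^sup>2, \<beta>\<^sup>2]}"
    using S by (simp add: is_S_def)
  interpret self_similar \<beta> "1 + 3 * \<beta>" S
    using S \<alpha> dp by unfold_locales (simp_all add: is_S_def)
  define L where "L = \<beta> * (\<beta> - 1)"
  have "0 \<le> L" using \<alpha> by (simp add: L_def)
  then have pos: "0 \<le> (\<beta> - 1) * L" "0 \<le> (\<beta> - \<alpha>) * L" "0 \<le> (\<alpha> - 1) * ((\<beta> - 1) * L)"
    "0 \<le> (\<alpha> - 1) * (\<beta> * L)" "0 \<le> \<alpha> * ((\<alpha> - 1) * L)" using \<alpha> by simp_all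
  have vals: "T_map \<alpha> \<beta> (point [1, \<beta>, \<beta>, \<beta>]) 1 = 0"
    "T_map \<alpha> \<beta> (point [1, \<beta>, \<beta>, \<beta>]) 2 = 0"
    "T_map \<alpha> \<beta> (point [1, \<beta>, \<beta>, \<beta>]) 3 = 0"
    "T_map \<alpha> \<beta> (point [1, \<beta>, \<beta>\<^sup>2, \<beta>\<^sup>2]) 1 = (\<beta> - 1) * L"
    "T_map \<alpha> \<beta> (point [1, \<beta>, \<beta>\<^sup>2, \<beta>\<^sup>2]) 2 = (\<alpha> - 1) * ((\<beta> - 1) * L)"
    "T_map \<alpha> \<beta> (point [1, \<beta>, \<beta>\<^sup>2, \<beta>\<^sup>2]) 3 = 0"
    "T_map \<alpha> \<beta> (point [\<beta>, \<beta>, \<beta>\<^sup>2, \<beta>\<^sup>2]) 1 = (\<beta> - \<alpha>) * L"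
    "T_map \<alpha> \<beta> (point [\<beta>, \<beta>, \<beta>\<^sup>2, \<beta>\<^sup>2]) 2 = (\<alpha> - 1) * (\<beta> * L)"
    "T_map \<alpha> \<beta> (point [\<beta>, \<beta>, \<beta>\<^sup>2, \<beta>\<^sup>2]) 3 = \<alpha> * ((\<alpha> - 1) * L)"
    "T_map \<alpha> \<beta> (point [\<beta>, \<beta>\<^sup>2, \<beta>\<^sup>2, \<beta>\<^sup>2]) 1 = 0"
    "T_map \<alpha> \<beta> (point [\<beta>, \<beta>\<^sup>2, \<beta>\<^sup>2, \<beta>\<^sup>2]) 2 = 0"
    "T_map \<alpha> \<beta> (point [\<beta>, \<beta>\<^sup>2, \<beta>\<^sup>2, \<beta>\<^sup>2]) 3 = 0"
    unfolding T_map_point L_def by algebra+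
  have nonneg: "0 \<le> T_map \<alpha> \<beta> x i"
    if "x \<in> division_points 4 {1 + 3 * \<beta>..\<beta> * (1 + 3 * \<beta>)} S" "i \<in> {1, 2, 3}" for x i
    using that unfolding dp by (elim insertE emptyE) (simp_all only: vals pos order_refl)
  show "0 \<le> mu (T_map \<alpha> \<beta>) S i" if i: "i \<in> {1, 2, 3}"
  proof (rule mu_nonneg)
    fix q assume "1 + 3 * \<beta> \<le> q"
    then show "0 \<le> T_map \<alpha> \<beta> (S q) i" using i nonneg by (intro T_map_nonneg) auto
  qed
  have "T_map \<alpha> \<beta> (point [1, \<beta>, \<beta>, \<beta>]) 5 \<le> 0 * (\<Sum>j = 1..4. point [1, \<beta>, \<beta>, \<beta>] j)"
    unfolding T_map_point by simp
  then show "mu (T_map \<alpha> \<beta>) S 5 \<le> ereal 0"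
    by (rule mu_le_division_point[rotated 2]) (simp_all add: dp)
qed

section \<open>Incompatibility of the five lower limits\<close>

theorem corollary4p2:
  fixes \<alpha> \<beta> :: real and R S :: "real \<Rightarrow> nat \<Rightarrow> real"
  assumes "1 < \<alpha>" and "\<alpha> < \<beta>"
    and "is_R \<alpha> R" and "is_S \<beta> S"
  shows "\<not> (\<exists>q0 P. proper_n_system 4 q0 P \<and>
           (\<forall>i\<in>{1..5}. mu (T_map \<alpha> \<beta>) P i =
              min (mu (T_map \<alpha> \<beta>) R i) (mu (T_map \<alpha> \<beta>) S i)))"
proof
  assume "\<exists>q0 P. proper_n_system 4 q0 P \<and> (\<forall>i\<in>{1..5}. mu (T_map \<alpha> \<beta>) P i =
    min (mu (T_map \<alpha> \<beta>) R i) (mu (T_map \<alpha> \<beta>) S i))"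
  then obtain q0 P where P: "proper_n_system 4 q0 P"
    and mu: "\<And>i. i \<in> {1..5} \<Longrightarrow>
      mu (T_map \<alpha> \<beta>) P i = min (mu (T_map \<alpha> \<beta>) R i) (mu (T_map \<alpha> \<beta>) S i)"
    by blast
  interpret proper_4_system \<alpha> \<beta> q0 P using assms P by unfold_locales
  define c where "c = \<alpha> * (\<alpha> - 1) / (2 + \<alpha> + \<alpha>\<^sup>2)"
  have "0 \<le> mu (T_map \<alpha> \<beta>) P i" if "i \<in> {1, 2, 3}" for i
    using mu[of i] mu_R(1)[OF assms(3,1,2) that] mu_S(1)[OF assms(4,1,2) that] that by auto
  note mu_nonneg = this
  have mu4: "mu (T_map \<alpha> \<beta>) P 4 \<le> ereal (- c)"
    using mu[of 4] mu_R(2)[OF assms(3,1,2)] by (simp add: c_def min.coboundedI1)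
  have mu5: "mu (T_map \<alpha> \<beta>) P 5 \<le> ereal 0"
    using mu[of 5] mu_S(2)[OF assms(4,1,2)] by (simp add: min.coboundedI2)
  have "\<forall>\<^sub>F \<epsilon> in at_right 0. \<epsilon> > (0::real)" using eventually_at_right_less by blast
  \<comment> \<open>A single \<open>\<epsilon>\<close> serves both statements; \<open>Q\<close> is
    chosen afterwards, depending on it.\<close>
  from eventually_happens'[OF trivial_limit_at_right_real
      eventually_conj[OF this eventually_conj[OF V_start no_extremal[OF c_def]]]]
  obtain \<epsilon> :: real where \<epsilon>: "0 < \<epsilon>"
    and start: "\<And>Q q. \<lbrakk>near_cone \<epsilon> Q; Q \<le> q; P q 4 - P q 2 \<le> \<epsilon> * q\<rbrakk> \<Longrightarrow> \<exists>t\<ge>q. P t 2 = P t 3 \<and> V t \<le> 0"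
    and ext: "\<And>Q s q. \<lbrakk>near_cone \<epsilon> Q; Q \<le> s; P s 2 = P s 3; V s \<le> 0; s \<le> q\<rbrakk>
      \<Longrightarrow> P q 4 - P q 3 < (c - \<epsilon>) * q"
    by blast
  have "\<forall>\<^sub>F q in at_top. \<forall>i\<in>{1, 2, 3}. - \<epsilon> * q \<le> T_map \<alpha> \<beta> (P q) i"
    using eventually_of_mu_nonneg[OF mu_nonneg \<epsilon>] by (intro eventually_ball_finite) auto
  then obtain Q0 where Q0: "\<And>q. Q0 \<le> q \<Longrightarrow> \<forall>i\<in>{1, 2, 3}. - \<epsilon> * q \<le> T_map \<alpha> \<beta> (P q) i"
    unfolding eventually_at_top_linorder by blast
  define Q where "Q = max Q0 (max q0 1)"
  have nc: "near_cone \<epsilon> Q" using Q0 \<epsilon> unfolding near_cone_def Q_def by auto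
  obtain q where q: "Q \<le> q" "T_map \<alpha> \<beta> (P q) 5 \<le> (0 + \<epsilon>) * q"
    using frequently_of_mu_le[OF mu5 \<epsilon>] .
  then obtain s where s: "q \<le> s" "P s 2 = P s 3" "V s \<le> 0"
    using start[OF nc q(1)] by (auto simp: T_map_simps)
  \<comment> \<open>T_4 asks for a gap of at least \<open>(c - \<epsilon>) * r\<close> at some time
    \<open>r\<close> after \<open>s\<close>, which \<open>ext\<close> excludes.\<close>
  obtain r where r: "s \<le> r" "T_map \<alpha> \<beta> (P r) 4 \<le> (- c + \<epsilon>) * r"
    using frequently_of_mu_le[OF mu4 \<epsilon>] .
  have "P r 4 - P r 3 < (c - \<epsilon>) * r" using ext[OF nc _ s(2,3) r(1)] q s by simp
  then show False using r(2) by (simp add: T_map_simps algebra_simps)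
qed

end
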